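(* Identify $W(\mathbb{B})$ with $\mathbb{N}^2\cup\{\infty\}$ via the bijection in which $(x,y)\in\mathbb{N}^2$ corresponds to the Witt vector with $m_\lambda\mapsto0$ if $\lambda_{x+1}\ge y+1$ and $m_\lambda\mapsto1$ otherwise, and $\infty$ corresponds to the Witt vector with $m_\lambda\mapsto1$ for all partitions $\lambda$. Then: (1) Under the unique semiring map $\mathbb{N}\to W(\mathbb{B})$, the image of an element $x$ is $(x,0)$. In particular, $0=(0,0)$, $1=(1,0)$, and $(x,0)+(x',0)=(x+x',0)$ for all $x,x'\in\mathbb{N}$. (2) $(x,0)+(0,y)=(x,y)$ for all $x,y\in\mathbb{N}$. (3) $(0,y)+(0,y')=(0,\max\{y,y'\})$ and $(0,y)(0,y')=(0,\min\{y,y'\})$ for all $y,y'\in\mathbb{N}$. (4) $\infty+z=\infty$ for all $z\in W(\mathbb{B})$. (5) $\infty\cdot\infty=\infty$ and $\infty\cdot(0,y)=(0,y)$ for all $y\in\mathbb{N}$. (6) For any nonzero partition $\lambda$, $m_\lambda(\infty)=\infty$ and $m_\lambda(0,y)=(0,[y/\lambda_1])$ for all $y\in\mathbb{N}$, where $[y/\lambda_1]$ denotes the greatest integer at most $y/\lambda_1$. (7) The bijection identifies the pointwise partial order $\preccurlyeq$ on $W(\mathbb{B})$ with the componentwise partial order on $\mathbb{N}^2\cup\{\infty\}$. That is, $(x_1,y_1)\preccurlyeq(x_2,y_2)$ if and only if $x_1\le x_2$ and $y_1\le y_2$, and $z\preccurlyeq\infty$ for all $z\in W(\mathbb{B})$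.
   Context: $\mathbb{N}=\{0,1,2,\dots\}$. Semirings are commutative with $0,1$; homomorphisms preserve $0,1$. $\mathbb{B}=\{0,1\}$ with $1+1=1$ and $0<1$. A partition is a sequence $\lambda=(\lambda_1\ge\lambda_2\ge\cdots)$ of natural numbers, eventually $0$. $\Lambda_{\mathbb{N}}=\bigoplus_\lambda\mathbb{N}m_\lambda$ is the semiring of symmetric functions in $x_1,x_2,\dots$ with coefficients in $\mathbb{N}$, with $m_\lambda$ the monomial symmetric functions. $W(A)=\mathrm{Hom}_{\mathrm{semiring}}(\Lambda_{\mathbb{N}},A)$. Semiring structure on $W(A)$: with $\Delta^+:f(\dots,x_i,\dots)\mapsto f(\dots,x_i\otimes1,1\otimes x_i,\dots)$ and $\Delta^\times:f(\dots,x_i,\dots)\mapsto f(\dots,x_i\otimes x_j,\dots)$, both maps $\Lambda_{\mathbb{N}}\to\Lambda_{\mathbb{N}}\otimes_{\mathbb{N}}\Lambda_{\mathbb{N}}$, the elements $a+b$ and $ab$ are the composites of $\Delta^+$ and $\Delta^\times$ with $f\otimes g\mapsto a(f)b(g)$; $0$ and $1$ are $f\mapsto f(0,0,\dots)$ and $f\mapsto f(1,0,0,\dots)$ (images in $A$). Action of $\Lambda_{\mathbb{N}}$ on $W(A)$: for $f\in\Lambda_{\mathbb{N}}$ and $a\in W(A)$, $f(a)\in W(A)$ is the map $g\mapsto a(g\circ f)$, where $\circ$ is plethysm. In particular $m_\lambda(a)$ denotes this action. The order on $W(\mathbb{B})$ is $a\preccurlyeq b$ iff $a(f)\le b(f)$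 for all $f\in\Lambda_{\mathbb{N}}$. *)

theory Defs
  imports
    "HOL-Library.Multiset"
    "HOL-Library.Nat_Bijection"
    "HOL-Library.Countable_Set"
    "HOL-Library.Product_Plus"
begin

text \<open>
  Conventions.  The variables \<open>x\<^sub>1, x\<^sub>2, \<dots>\<close> are indexed by \<^typ>\<open>nat\<close>, starting at 0.  A monomial
  is the finite multiset of its variables, so that \<open>count\<close> gives exponents, \<open>+\<close> is the product of
  monomials and \<open>size\<close> is the degree.  Likewise \<^typ>\<open>nat multiset \<times> nat multiset\<close> is the type of
  monomials in the two sets of variables \<open>x\<^sub>i \<otimes> 1\<close> and \<open>1 \<otimes> x\<^sub>i\<close>.
\<close>

section \<open>The Boolean semiring\<close>

datatype boole = B0 | B1

instantiation boole :: comm_semiring_1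
begin

definition zero_boole :: boole where "0 = B0"
definition one_boole :: boole where "1 = B1"

fun plus_boole :: "boole \<Rightarrow> boole \<Rightarrow> boole" where
  "B0 + b = b"
| "B1 + b = B1"

fun times_boole :: "boole \<Rightarrow> boole \<Rightarrow> boole" where
  "B0 * b = B0"
| "B1 * b = b"

instance
proof
  fix a b c :: boole
  show "a * b * c = a * (b * c)" by (cases a) auto
  show "a * b = b * a" by (cases a; cases b) auto
  show "1 * a = a" by (simp add: one_boole_def)
  show "a + b + c = a + (b + c)" by (cases a) auto
  show "a + b = b + a" by (cases a; cases b) auto
  show "0 + a = a" by (simp add: zero_boole_def)
  show "(a + b) * c = a * c + b * c" by (cases a; cases b; cases c) auto
  show "0 * a = 0" by (simp add: zero_boole_def)
  show "a * 0 = 0" by (cases a) (simp_all add: zero_boole_def)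
  show "(0::boole) \<noteq> 1" by (simp add: zero_boole_def one_boole_def)
qed

end

instantiation boole :: linorder
begin

definition less_eq_boole :: "boole \<Rightarrow> boole \<Rightarrow> bool" where
  "a \<le> b \<longleftrightarrow> a = B0 \<or> b = B1"

definition less_boole :: "boole \<Rightarrow> boole \<Rightarrow> bool" where
  "a < b \<longleftrightarrow> a = B0 \<and> b = B1"

instance
proof
  fix a b c :: boole
  show "(a < b) = (a \<le> b \<and> \<not> b \<le> a)"
    by (cases a; cases b) (auto simp: less_boole_def less_eq_boole_def zero_boole_def one_boole_def)
  show "a \<le> a" by (cases a) (auto simp: less_eq_boole_def zero_boole_def one_boole_def)
  show "a \<le> b \<Longrightarrow> b \<le> c \<Longrightarrow> a \<le> c"
    by (auto simp: less_eq_boole_def zero_boole_def one_boole_def)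
  show "a \<le> b \<Longrightarrow> b \<le> a \<Longrightarrow> a = b"
    by (auto simp: less_eq_boole_def zero_boole_def one_boole_def)
  show "a \<le> b \<or> b \<le> a"
    by (cases a; cases b) (auto simp: less_eq_boole_def zero_boole_def one_boole_def)
qed

end

section \<open>Partitions\<close>

text \<open>Indexing starts at 0: the part \<open>\<alpha>\<^sub>i\<close> of the literature is \<open>part \<alpha> (i - 1)\<close>.\<close>

typedef partition = "{p :: nat \<Rightarrow> nat. antimono p \<and> (\<exists>N. \<forall>n\<ge>N. p n = 0)}"
  morphisms part Abs_partition
  by (rule exI[of _ "\<lambda>_. 0"]) (auto simp: antimono_def)

setup_lifting type_definition_partition

text \<open>The monomial \<open>x\<^sub>1\<^bsup>\<alpha>\<^sub>1\<^esup> x\<^sub>2\<^bsup>\<alpha>\<^sub>2\<^esup> \<dots>\<close>.\<close>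

definition part_mono :: "partition \<Rightarrow> nat multiset" where
  "part_mono \<alpha> = Abs_multiset (part \<alpha>)"

lemma finite_part_pos: "finite {i. 0 < part \<alpha> i}"
proof -
  obtain N where "\<forall>n\<ge>N. part \<alpha> n = 0" using part[of \<alpha>] by auto
  hence "{i. 0 < part \<alpha> i} \<subseteq> {..<N}" by (metis (mono_tags, lifting) lessThan_iff mem_Collect_eq not_less less_irrefl subsetI)
  thus ?thesis by (rule finite_subset) simp
qed

lemma count_part_mono [simp]: "count (part_mono \<alpha>) = part \<alpha>"
  unfolding part_mono_def by (rule Abs_multiset_inverse) (simp add: finite_part_pos)

section \<open>The semiring of symmetric functions with natural number coefficients\<close>

definition is_sym :: "(nat multiset \<Rightarrow> nat) \<Rightarrow> bool" where
  "is_sym f \<longleftrightarrow> (\<forall>\<pi>. bij \<pi> \<longrightarrow> (\<forall>\<gamma>. f (image_mset \<pi> \<gamma>) = f \<gamma>))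
    \<and> (\<exists>d. \<forall>\<gamma>. f \<gamma> \<noteq> 0 \<longrightarrow> size \<gamma> \<le> d)"

typedef sym = "{f. is_sym f}"
  morphisms coeff Abs_sym
  by (rule exI[of _ "\<lambda>_. 0"]) (auto simp: is_sym_def)

setup_lifting type_definition_sym

lemma is_sym_coeff [simp]: "is_sym (coeff f)"
  using coeff[of f] by simp

lemma is_symD: "is_sym f \<Longrightarrow> bij \<pi> \<Longrightarrow> f (image_mset \<pi> \<gamma>) = f \<gamma>"
  by (simp add: is_sym_def)

lemma image_mset_inv [simp]:
  assumes "bij \<pi>"
  shows "image_mset (inv \<pi>) (image_mset \<pi> \<gamma>) = \<gamma>" "image_mset \<pi> (image_mset (inv \<pi>) \<gamma>) = \<gamma>"
proof -
  have "inv \<pi> \<circ> \<pi> = id" "\<pi> \<circ> inv \<pi> = id"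
    using assms by (auto simp: fun_eq_iff bij_is_inj bij_is_surj surj_f_inv_f)
  thus "image_mset (inv \<pi>) (image_mset \<pi> \<gamma>) = \<gamma>" "image_mset \<pi> (image_mset (inv \<pi>) \<gamma>) = \<gamma>"
    by (simp_all only: multiset.map_comp multiset.map_id)
qed

lemma bij_image_mset: "bij (\<pi> :: 'v \<Rightarrow> 'v) \<Longrightarrow> bij (image_mset \<pi>)"
  by (rule o_bij[of "image_mset (inv \<pi>)"]) (simp_all only: fun_eq_iff o_apply id_apply image_mset_inv simp_thms)

lemma finite_bounded_multisets:
  assumes "finite A"
  shows "finite {\<gamma>. set_mset \<gamma> \<subseteq> A \<and> size \<gamma> \<le> d}"
proof -
  have "{\<gamma>. set_mset \<gamma> \<subseteq> A \<and> size \<gamma> \<le> d} \<subseteq> mset ` {xs. set xs \<subseteq> A \<and> length xs \<le> d}"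
  proof
    fix \<gamma> assume "\<gamma> \<in> {\<gamma>. set_mset \<gamma> \<subseteq> A \<and> size \<gamma> \<le> d}"
    moreover obtain xs where "\<gamma> = mset xs" using ex_mset[of \<gamma>] by auto
    ultimately show "\<gamma> \<in> mset ` {xs. set xs \<subseteq> A \<and> length xs \<le> d}" by auto
  qed
  thus ?thesis by (rule finite_subset) (simp add: finite_lists_length_le assms)
qed

lemma finite_decomp: "finite {p. fst p + snd p = (\<gamma> :: 'v multiset)}"
proof -
  let ?S = "{\<gamma>'. set_mset \<gamma>' \<subseteq> set_mset \<gamma> \<and> size \<gamma>' \<le> size \<gamma>}"
  have "{p. fst p + snd p = \<gamma>} \<subseteq> ?S \<times> ?S" by auto
  thus ?thesis by (rule finite_subset) (simp add: finite_bounded_multisets)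
qed

instantiation sym :: comm_semiring_1
begin

lift_definition zero_sym :: sym is "\<lambda>_. 0"
  by (simp add: is_sym_def)

lift_definition one_sym :: sym is "\<lambda>\<gamma>. if \<gamma> = {#} then 1 else 0"
  by (auto simp: is_sym_def)

lift_definition plus_sym :: "sym \<Rightarrow> sym \<Rightarrow> sym" is "\<lambda>f g \<gamma>. f \<gamma> + g \<gamma>"
proof -
  fix f g assume "is_sym f" "is_sym g"
  moreover from this obtain d e where "\<forall>\<gamma>. f \<gamma> \<noteq> 0 \<longrightarrow> size \<gamma> \<le> d" "\<forall>\<gamma>. g \<gamma> \<noteq> 0 \<longrightarrow> size \<gamma> \<le> e"
    by (auto simp: is_sym_def)
  hence "\<forall>\<gamma>. f \<gamma> + g \<gamma> \<noteq> 0 \<longrightarrow> size \<gamma> \<le> max d e" by (auto simp: le_max_iff_disj)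
  ultimately show "is_sym (\<lambda>\<gamma>. f \<gamma> + g \<gamma>)" unfolding is_sym_def by metis
qed

lift_definition times_sym :: "sym \<Rightarrow> sym \<Rightarrow> sym" is
  "\<lambda>f g \<gamma>. \<Sum>p | fst p + snd p = \<gamma>. f (fst p) * g (snd p)"
proof -
  fix f g assume fg: "is_sym f" "is_sym g"
  obtain d e where d: "\<forall>\<gamma>. f \<gamma> \<noteq> 0 \<longrightarrow> size \<gamma> \<le> d" and e: "\<forall>\<gamma>. g \<gamma> \<noteq> 0 \<longrightarrow> size \<gamma> \<le> e"
    using fg by (auto simp: is_sym_def)
  let ?h = "\<lambda>\<gamma>. \<Sum>p | fst p + snd p = \<gamma>. f (fst p) * g (snd p)"
  have "?h (image_mset \<pi> \<gamma>) = ?h \<gamma>" if \<pi>: "bij \<pi>" for \<pi> \<gamma>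
    by (rule sum.reindex_bij_witness[of _ "map_prod (image_mset \<pi>) (image_mset \<pi>)"
          "map_prod (image_mset (inv \<pi>)) (image_mset (inv \<pi>))"])
       (use \<pi> fg in \<open>auto simp: is_symD bij_imp_bij_inv simp flip: image_mset_union\<close>)
  moreover have "size \<gamma> \<le> d + e" if nz: "?h \<gamma> \<noteq> 0" for \<gamma>
  proof -
    from nz obtain p where "fst p + snd p = \<gamma>" "f (fst p) * g (snd p) \<noteq> 0"
      using sum.not_neutral_contains_not_neutral[OF nz] by auto
    with d e show ?thesis by (metis add_mono mult_eq_0_iff size_union)
  qed
  ultimately show "is_sym ?h" unfolding is_sym_def by blast
qed

instance
proof
  fix a b c :: sym
  show "a * b * c = a * (b * c)"
  proof (transfer, rule ext)
    fix a b c :: "nat multiset \<Rightarrow> nat" and \<gamma>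
    let ?P = "\<lambda>\<gamma> :: nat multiset. {p. fst p + snd p = \<gamma>}"
    have "(\<Sum>p\<in>?P \<gamma>. (\<Sum>q\<in>?P (fst p). a (fst q) * b (snd q)) * c (snd p))
        = (\<Sum>(p,q)\<in>Sigma (?P \<gamma>) (\<lambda>p. ?P (fst p)). a (fst q) * b (snd q) * c (snd p))"
      by (simp add: sum_distrib_right sum.Sigma finite_decomp)
    also have "\<dots> = (\<Sum>(p,q)\<in>Sigma (?P \<gamma>) (\<lambda>p. ?P (snd p)). a (fst p) * (b (fst q) * c (snd q)))"
      by (rule sum.reindex_bij_witness[of _
            "\<lambda>(p,q). ((fst p + fst q, snd q), (fst p, fst q))"
            "\<lambda>(p,q). ((fst q, snd q + snd p), (snd q, snd p))"]) (auto simp: ac_simps)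
    also have "\<dots> = (\<Sum>p\<in>?P \<gamma>. a (fst p) * (\<Sum>q\<in>?P (snd p). b (fst q) * c (snd q)))"
      by (simp add: sum_distrib_left sum.Sigma finite_decomp)
    finally show "(\<Sum>p\<in>?P \<gamma>. (\<Sum>q\<in>?P (fst p). a (fst q) * b (snd q)) * c (snd p)) = \<dots>" .
  qed
  show "a * b = b * a"
    by (transfer, rule ext, rule sum.reindex_bij_witness[of _ prod.swap prod.swap])
       (auto simp: ac_simps)
  show "1 * a = a"
  proof (transfer, rule ext)
    fix a :: "nat multiset \<Rightarrow> nat" and \<gamma>
    have "(\<Sum>p | fst p + snd p = \<gamma>. (if fst p = {#} then 1 else 0) * a (snd p))
        = (\<Sum>p\<in>{({#} :: nat multiset, \<gamma>)}. (if fst p = {#} then 1 else 0) * a (snd p))"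
      by (rule sum.mono_neutral_right[OF finite_decomp]) auto
    thus "(\<Sum>p | fst p + snd p = \<gamma>. (if fst p = {#} then 1 else 0) * a (snd p)) = a \<gamma>" by simp
  qed
  show "a + b + c = a + (b + c)" by transfer (simp add: ac_simps)
  show "a + b = b + a" by transfer (simp add: ac_simps)
  show "0 + a = a" by transfer simp
  show "(a + b) * c = a * c + b * c"
    by transfer (simp add: distrib_right sum.distrib)
  show "0 * a = 0" by transfer simp
  show "a * 0 = 0" by transfer simp
  show "(0::sym) \<noteq> 1" by transfer (auto simp: fun_eq_iff)
qed

end

text \<open>The monomial symmetric function: the sum of all distinct monomials obtained from
  \<open>part_mono \<lambda>\<close> by permuting the variables.\<close>

lift_definition msym :: "partition \<Rightarrow> sym" is
  "\<lambda>\<alpha> \<gamma>. if \<exists>\<pi>. bij \<pi> \<and> \<gamma> = image_mset \<pi> (part_mono \<alpha>) then 1 else 0"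
proof -
  fix \<alpha> :: partition
  have "(\<exists>\<rho>. bij \<rho> \<and> image_mset \<pi> \<gamma> = image_mset \<rho> (part_mono \<alpha>))
      \<longleftrightarrow> (\<exists>\<rho>. bij \<rho> \<and> \<gamma> = image_mset \<rho> (part_mono \<alpha>))" if \<pi>: "bij \<pi>" for \<pi> :: "nat \<Rightarrow> nat" and \<gamma>
  proof safe
    fix \<rho> assume "bij \<rho>" "image_mset \<pi> \<gamma> = image_mset \<rho> (part_mono \<alpha>)"
    hence "image_mset (inv \<pi>) (image_mset \<pi> \<gamma>) = image_mset (inv \<pi> \<circ> \<rho>) (part_mono \<alpha>)"
      by (simp add: multiset.map_comp)
    thus "\<exists>\<rho>. bij \<rho> \<and> \<gamma> = image_mset \<rho> (part_mono \<alpha>)"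
      using \<pi> \<open>bij \<rho>\<close> by (metis bij_comp bij_imp_bij_inv image_mset_inv(1))
  next
    fix \<rho> :: "nat \<Rightarrow> nat" assume "bij \<rho>"
    thus "\<exists>\<rho>'. bij \<rho>' \<and> image_mset \<pi> (image_mset \<rho> (part_mono \<alpha>)) = image_mset \<rho>' (part_mono \<alpha>)"
      using \<pi> by (intro exI[of _ "\<pi> \<circ> \<rho>"]) (simp add: multiset.map_comp bij_comp)
  qed
  thus "is_sym (\<lambda>\<gamma>. if \<exists>\<pi>. bij \<pi> \<and> \<gamma> = image_mset \<pi> (part_mono \<alpha>) then 1 else 0)"
    unfolding is_sym_def by (auto intro!: exI[of _ "size (part_mono \<alpha>)"])
qed

section \<open>The monomial basis\<close>

lemma down_closed_nat:
  fixes D :: "nat set"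
  assumes "finite D" "\<And>i j. j \<in> D \<Longrightarrow> i \<le> j \<Longrightarrow> i \<in> D"
  shows "D = {..<card D}"
proof (cases "D = {}")
  case False
  have "D = {..Max D}" using assms False by (auto intro: Max_ge assms(2)[OF Max_in])
  thus ?thesis by (metis card_atMost lessThan_Suc_atMost)
qed simp

lemma part_antimono: "i \<le> j \<Longrightarrow> part \<alpha> j \<le> part \<alpha> i"
  using part[of \<alpha>] by (auto simp: antimono_def)

lemma part_level: "{i. k < part \<alpha> i} = {..<card {i. k < part \<alpha> i}}"
proof (rule down_closed_nat)
  show "finite {i. k < part \<alpha> i}"
    by (rule finite_subset[OF _ finite_part_pos[of \<alpha>]]) auto
qed (auto intro: less_le_trans part_antimono)

lemma count_image_mset_bij: "bij \<pi> \<Longrightarrow> count (image_mset \<pi> \<gamma>) (\<pi> i) = count \<gamma> i"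
proof -
  assume "bij \<pi>"
  hence "{j. j \<in># \<gamma> \<and> \<pi> i = \<pi> j} = (if i \<in># \<gamma> then {i} else {})" by (auto simp: bij_is_inj inj_eq)
  thus ?thesis by (simp add: count_image_mset' not_in_iff)
qed

lemma part_mono_orbit_unique:
  assumes "bij \<pi>" "part_mono \<beta> = image_mset \<pi> (part_mono \<alpha>)"
  shows "\<alpha> = \<beta>"
proof -
  have *: "part \<beta> (\<pi> i) = part \<alpha> i" for i
    using count_image_mset_bij[of \<pi> "part_mono \<alpha>" i] assms by (metis count_part_mono)
  have "k < part \<alpha> i \<longleftrightarrow> k < part \<beta> i" for k i
  proof -
    have "{i. k < part \<beta> i} = \<pi> ` {i. k < part \<alpha> i}"
    proof safe
      fix j assume "k < part \<beta> j"
      moreover obtain i where "j = \<pi> i" using assms(1) by (metis bij_pointE)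
      ultimately show "j \<in> \<pi> ` {i. k < part \<alpha> i}" using * by auto
    qed (simp add: *)
    hence "card {i. k < part \<beta> i} = card {i. k < part \<alpha> i}"
      using assms(1) by (metis bij_is_inj card_image inj_on_subset subset_UNIV)
    thus ?thesis using part_level[of k \<alpha>] part_level[of k \<beta>] by auto
  qed
  hence "part \<alpha> = part \<beta>" by (metis ext linorder_neqE_nat less_irrefl)
  thus ?thesis by (simp add: part_inject)
qed

lemma part_mono_orbit_exists: "\<exists>\<alpha> \<pi>. bij \<pi> \<and> (\<gamma> :: nat multiset) = image_mset \<pi> (part_mono \<alpha>)"
proof -
  define xs where "xs = rev (sort_key (count \<gamma>) (sorted_list_of_set (set_mset \<gamma>)))"
  define n where "n = length xs"
  define p where "p i = (if i < n then count \<gamma> (xs ! i) else 0)" for i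
  have xs: "set xs = set_mset \<gamma>" "distinct xs" by (auto simp: xs_def)
  have "sorted_wrt (\<ge>) (map (count \<gamma>) xs)"
    unfolding xs_def by (simp only: rev_map[symmetric] sorted_wrt_rev sorted_sort_key)
  hence "p j \<le> p i" if "i \<le> j" for i j
    using that by (cases "i = j") (auto simp: p_def n_def sorted_wrt_iff_nth_less)
  hence p: "p \<in> {p. antimono p \<and> (\<exists>N. \<forall>n\<ge>N. p n = 0)}"
    by (auto simp: antimono_def p_def intro!: exI[of _ n])
  obtain h where h: "bij_betw h {n..} (- set xs)"
  proof -
    have "infinite {n..}" "infinite (- set xs)" by (auto simp: infinite_Ici finite_compl)
    hence "bij_betw (to_nat_on {n..}) {n..} UNIV" "bij_betw (from_nat_into (- set xs)) UNIV (- set xs)"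
      by (auto intro: to_nat_on_infinite bij_betw_from_nat_into)
    thus thesis using that bij_betw_trans by blast
  qed
  define \<pi> where "\<pi> i = (if i < n then xs ! i else h i)" for i
  have "bij_betw \<pi> {..<n} (set xs)"
    using bij_betw_nth[OF xs(2), of "{..<n}" "set xs"]
    by (subst bij_betw_cong[of _ _ "(!) xs"]) (auto simp: \<pi>_def n_def)
  moreover have "bij_betw \<pi> {n..} (- set xs)"
    using h by (subst bij_betw_cong[of _ _ h]) (auto simp: \<pi>_def)
  ultimately have "bij_betw \<pi> ({..<n} \<union> {n..}) (set xs \<union> - set xs)"
    by (rule bij_betw_combine) auto
  moreover have "{..<n} \<union> {n..} = UNIV" by auto
  ultimately have \<pi>: "bij \<pi>" by simp
  have "\<gamma> = image_mset \<pi> (part_mono (Abs_partition p))"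
  proof (rule multiset_eqI)
    fix j
    obtain i where i: "j = \<pi> i" using \<pi> by (metis bij_pointE)
    have "count (image_mset \<pi> (part_mono (Abs_partition p))) j = p i"
      unfolding i using \<pi> p by (simp add: count_image_mset_bij Abs_partition_inverse)
    also have "p i = count \<gamma> j"
    proof (cases "i < n")
      case False
      hence "j \<in> - set xs" using h i by (auto simp: \<pi>_def bij_betw_def)
      thus ?thesis using False xs by (simp add: p_def not_in_iff)
    qed (simp add: p_def i \<pi>_def)
    finally show "count \<gamma> j = count (image_mset \<pi> (part_mono (Abs_partition p))) j" by simp
  qed
  thus ?thesis using \<pi> by blast
qed

lemma coeff_msym: "coeff (msym \<alpha>) (part_mono \<beta>) = (if \<alpha> = \<beta> then 1 else 0)"
proof (cases "\<alpha> = \<beta>")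
  case True
  have "\<exists>\<pi>. bij \<pi> \<and> part_mono \<beta> = image_mset \<pi> (part_mono \<beta>)"
    by (rule exI[of _ id]) (simp add: multiset.map_id)
  thus ?thesis using True by (simp add: msym.rep_eq)
qed (auto simp: msym.rep_eq dest: part_mono_orbit_unique)

lemma sym_eqI:
  assumes "\<And>\<alpha>. coeff f (part_mono \<alpha>) = coeff g (part_mono \<alpha>)"
  shows "f = g"
proof -
  have "coeff f \<gamma> = coeff g \<gamma>" for \<gamma>
    using part_mono_orbit_exists[of \<gamma>] assms by (auto simp: is_symD)
  thus ?thesis by (simp add: coeff_inject[symmetric] fun_eq_iff)
qed

lemma finite_sym_support: "finite {\<alpha>. coeff f (part_mono \<alpha>) \<noteq> 0}"
proof (rule finite_imageD)
  obtain d where d: "\<forall>\<gamma>. coeff f \<gamma> \<noteq> 0 \<longrightarrow> size \<gamma> \<le> d"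
    using is_sym_coeff[of f] unfolding is_sym_def by blast
  have "part_mono ` {\<alpha>. coeff f (part_mono \<alpha>) \<noteq> 0} \<subseteq> {\<gamma>. set_mset \<gamma> \<subseteq> {..<d} \<and> size \<gamma> \<le> d}"
  proof safe
    fix \<alpha> i assume nz: "0 < coeff f (part_mono \<alpha>)" and i: "i \<in># part_mono \<alpha>"
    have "{..i} \<subseteq> set_mset (part_mono \<alpha>)"
      using i by (auto simp: set_mset_def intro: less_le_trans part_antimono)
    hence "card {..i} \<le> card (set_mset (part_mono \<alpha>))" by (intro card_mono) auto
    also have "\<dots> \<le> size (part_mono \<alpha>)"
      by (simp add: size_multiset_overloaded_eq card_eq_sum del: count_part_mono sum_constant)
         (rule sum_mono, simp add: Suc_le_eq del: count_part_mono)
    finally show "i < d" using d nz by fastforce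
  qed (use d in auto)
  thus "finite (part_mono ` {\<alpha>. coeff f (part_mono \<alpha>) \<noteq> 0})"
    by (rule finite_subset) (rule finite_bounded_multisets, simp)
  show "inj_on part_mono {\<alpha>. coeff f (part_mono \<alpha>) \<noteq> 0}"
    by (rule inj_onI) (metis count_part_mono part_inject)
qed

lemma coeff_sum: "coeff (\<Sum>x\<in>A. F x) \<gamma> = (\<Sum>x\<in>A. coeff (F x) \<gamma>)"
  by (induction A rule: infinite_finite_induct) (simp_all add: zero_sym.rep_eq plus_sym.rep_eq)

lemma coeff_of_nat_mult: "coeff (of_nat n * f) \<gamma> = n * coeff f \<gamma>"
  by (induction n) (simp_all add: zero_sym.rep_eq plus_sym.rep_eq distrib_right)

lemma sym_expand:
  "f = (\<Sum>\<alpha> | coeff f (part_mono \<alpha>) \<noteq> 0. of_nat (coeff f (part_mono \<alpha>)) * msym \<alpha>)"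
  by (rule sym_eqI)
     (simp add: coeff_sum coeff_of_nat_mult coeff_msym finite_sym_support[simplified] if_distrib cong: if_cong)

lemma additive_expand:
  fixes a :: "sym \<Rightarrow> 'a :: comm_semiring_1"
  assumes "a 0 = 0" "\<And>f g. a (f + g) = a f + a g"
  shows "a f = (\<Sum>\<alpha> | coeff f (part_mono \<alpha>) \<noteq> 0. of_nat (coeff f (part_mono \<alpha>)) * a (msym \<alpha>))"
proof -
  have of_nat: "a (of_nat n * g) = of_nat n * a g" for n g
    by (induction n) (simp_all add: assms distrib_right)
  have sum: "a (\<Sum>x\<in>A. F x) = (\<Sum>x\<in>A. a (F x))" for A :: "partition set" and F
    by (induction A rule: infinite_finite_induct) (simp_all add: assms)
  show ?thesis by (subst sym_expand[of f]) (simp only: sum of_nat)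
qed

section \<open>Substitution of monomials for the variables\<close>

text \<open>
  For a symmetric function \<open>f\<close>, \<open>subst f y \<mu>\<close> is the coefficient of the monomial \<open>\<mu>\<close> in
  \<open>f(y\<^sub>0, y\<^sub>1, \<dots>)\<close>, where \<open>y i = Some \<kappa>\<close> substitutes the monomial \<open>\<kappa>\<close> for \<open>x\<^sub>i\<close> and \<open>y i = None\<close>
  substitutes 0.  By symmetry of \<open>f\<close> only the multiset of the substituted monomials matters, so a
  family indexed by any countable set may be substituted after an arbitrary enumeration.
\<close>

definition subst ::
  "(nat multiset \<Rightarrow> nat) \<Rightarrow> (nat \<Rightarrow> 'm :: comm_monoid_add option) \<Rightarrow> 'm \<Rightarrow> nat" where
  "subst f y \<mu> =
    (\<Sum>\<gamma> | f \<gamma> \<noteq> 0 \<and> (\<forall>i\<in>#\<gamma>. y i \<noteq> None) \<and> (\<Sum>i\<in>#\<gamma>. the (y i)) = \<mu>. f \<gamma>)"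

text \<open>The sum in \<^const>\<open>subst\<close> is finite whenever each monomial has only finitely many divisors among
  the substituted ones.\<close>

lemma finite_subst:
  fixes y :: "nat \<Rightarrow> 'm :: comm_monoid_add option"
  assumes f: "is_sym f" and y: "finite {i. \<exists>\<kappa> \<nu>. y i = Some \<kappa> \<and> \<kappa> + \<nu> = \<mu>}"
  shows "finite {\<gamma>. f \<gamma> \<noteq> 0 \<and> (\<forall>i\<in>#\<gamma>. y i \<noteq> None) \<and> (\<Sum>i\<in>#\<gamma>. the (y i)) = \<mu>}"
proof -
  obtain d where d: "\<forall>\<gamma>. f \<gamma> \<noteq> 0 \<longrightarrow> size \<gamma> \<le> d" using f by (auto simp: is_sym_def)
  let ?A = "{i. \<exists>\<kappa> \<nu>. y i = Some \<kappa> \<and> \<kappa> + \<nu> = \<mu>}"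
  have "{\<gamma>. f \<gamma> \<noteq> 0 \<and> (\<forall>i\<in>#\<gamma>. y i \<noteq> None) \<and> (\<Sum>i\<in>#\<gamma>. the (y i)) = \<mu>}
      \<subseteq> {\<gamma>. set_mset \<gamma> \<subseteq> ?A \<and> size \<gamma> \<le> d}"
  proof safe
    fix \<gamma> i assume *: "\<forall>i\<in>#\<gamma>. y i \<noteq> None" "\<mu> = (\<Sum>i\<in>#\<gamma>. the (y i))" "i \<in># \<gamma>"
    then obtain \<kappa> where \<kappa>: "y i = Some \<kappa>" by auto
    have "(\<Sum>i\<in>#\<gamma>. the (y i)) = \<kappa> + (\<Sum>i\<in>#\<gamma> - {#i#}. the (y i))"
      using multi_member_split[OF *(3)] \<kappa> by auto
    thus "\<exists>\<kappa> \<nu>. y i = Some \<kappa> \<and> \<kappa> + \<nu> = (\<Sum>i\<in>#\<gamma>. the (y i))" using \<kappa> by auto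
  qed (use d in auto)
  thus ?thesis using finite_bounded_multisets[OF y] by (rule finite_subset)
qed

lemma subst_invariant:
  fixes y :: "nat \<Rightarrow> 'm :: comm_monoid_add option"
  assumes f: "is_sym f" and \<sigma>: "bij \<sigma>" and T: "inj T"
    and T0: "T 0 = 0" and T_add: "\<And>a b. T (a + b) = T a + T b"
    and y: "\<And>i. y (\<sigma> i) = map_option T (y i)"
  shows "subst f y (T \<mu>) = subst f y \<mu>"
proof -
  have sum: "(\<Sum>i\<in>#image_mset \<sigma> \<gamma>. the (y i)) = T (\<Sum>i\<in>#\<gamma>. the (y i))"
    if "\<forall>i\<in>#\<gamma>. y i \<noteq> None" for \<gamma>
    using that by (induction \<gamma>) (auto simp: T0 T_add y)
  have y': "y (inv \<sigma> i) = None \<longleftrightarrow> y i = None" for i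
    using y[of "inv \<sigma> i"] \<sigma> by (simp add: bij_is_surj surj_f_inv_f)
  have sum': "T (\<Sum>i\<in>#image_mset (inv \<sigma>) \<gamma>. the (y i)) = (\<Sum>i\<in>#\<gamma>. the (y i))"
    if "\<forall>i\<in>#\<gamma>. y i \<noteq> None" for \<gamma>
    using sum[of "image_mset (inv \<sigma>) \<gamma>"] that \<sigma> by (simp only: image_mset_inv set_image_mset ball_simps y' not_False_eq_True simp_thms)
  let ?S = "\<lambda>\<mu>. {\<gamma>. f \<gamma> \<noteq> 0 \<and> (\<forall>i\<in>#\<gamma>. y i \<noteq> None) \<and> (\<Sum>i\<in>#\<gamma>. the (y i)) = \<mu>}"
  show ?thesis
    unfolding subst_def
  proof (rule sum.reindex_bij_witness[of _ "image_mset \<sigma>" "image_mset (inv \<sigma>)"])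
    fix \<gamma> assume \<gamma>: "\<gamma> \<in> ?S (T \<mu>)"
    show "image_mset \<sigma> (image_mset (inv \<sigma>) \<gamma>) = \<gamma>" using \<sigma> by (rule image_mset_inv)
    show "f (image_mset (inv \<sigma>) \<gamma>) = f \<gamma>" using f \<sigma> by (simp add: is_symD bij_imp_bij_inv)
    moreover have "T (\<Sum>i\<in>#image_mset (inv \<sigma>) \<gamma>. the (y i)) = T \<mu>" using \<gamma> sum' by simp
    ultimately show "image_mset (inv \<sigma>) \<gamma> \<in> ?S \<mu>"
      using \<gamma> T y' by (simp only: mem_Collect_eq set_image_mset ball_simps inj_eq) simp
  next
    fix \<gamma> assume \<gamma>: "\<gamma> \<in> ?S \<mu>"
    show "image_mset (inv \<sigma>) (image_mset \<sigma> \<gamma>) = \<gamma>" using \<sigma> by (rule image_mset_inv)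
    have "f (image_mset \<sigma> \<gamma>) = f \<gamma>" using f \<sigma> by (rule is_symD)
    moreover have "(\<Sum>i\<in>#image_mset \<sigma> \<gamma>. the (y i)) = T \<mu>" using \<gamma> sum by simp
    ultimately show "image_mset \<sigma> \<gamma> \<in> ?S (T \<mu>)" using \<gamma> y by simp
  qed
qed

lemma subst_degree:
  assumes f: "\<forall>\<gamma>. f \<gamma> \<noteq> 0 \<longrightarrow> size \<gamma> \<le> d" and nz: "subst f y \<mu> \<noteq> 0"
    and D: "D 0 = (0 :: nat)" "\<And>a b. D (a + b) = D a + D b" "\<And>i \<kappa>. y i = Some \<kappa> \<Longrightarrow> D \<kappa> \<le> e"
  shows "D \<mu> \<le> d * e"
proof -
  from nz obtain \<gamma> where \<gamma>: "f \<gamma> \<noteq> 0" "\<forall>i\<in>#\<gamma>. y i \<noteq> None" "(\<Sum>i\<in>#\<gamma>. the (y i)) = \<mu>"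
    unfolding subst_def using sum.not_neutral_contains_not_neutral by blast
  have "D (\<Sum>i\<in>#\<gamma>. the (y i)) \<le> size \<gamma> * e"
    using \<gamma>(2) by (induction \<gamma>) (auto simp: D intro!: add_mono D(3))
  also have "\<dots> \<le> d * e" using f \<gamma>(1) by simp
  finally show ?thesis using \<gamma>(3) by simp
qed

section \<open>Plethysm\<close>

instance multiset :: (countable) countable
proof
  have "inj (\<lambda>M :: 'a multiset. to_nat (SOME xs. mset xs = M))"
    by (rule injI) (metis (mono_tags, lifting) ex_mset from_nat_to_nat someI_ex)
  thus "\<exists>f :: 'a multiset \<Rightarrow> nat. inj f" by blast
qed

text \<open>The monomials of \<open>f\<close>, each listed as often as its coefficient says: the \<open>k\<close>-th copy of \<open>\<mu>\<close>, where
  \<open>k < f \<mu>\<close>, sits at the index \<open>to_nat (\<mu>, k)\<close>; all other indices carry 0.\<close>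

definition monomials_of :: "(nat multiset \<Rightarrow> nat) \<Rightarrow> nat \<Rightarrow> nat multiset option" where
  "monomials_of f i =
    (if \<exists>\<mu> k. k < f \<mu> \<and> i = to_nat (\<mu>, k) then Some (fst (from_nat i :: nat multiset \<times> nat)) else None)"

lemma monomials_of_to_nat [simp]:
  "monomials_of f (to_nat (\<mu>, k)) = (if k < f \<mu> then Some \<mu> else None)"
  unfolding monomials_of_def by auto

lemma monomials_of_outside:
  "i \<notin> range (to_nat :: nat multiset \<times> nat \<Rightarrow> nat) \<Longrightarrow> monomials_of f i = None"
  unfolding monomials_of_def by auto

lemma monomials_of_SomeD: "monomials_of f i = Some \<kappa> \<Longrightarrow> f \<kappa> \<noteq> 0"
  unfolding monomials_of_def by (auto split: if_splits)

lemma finite_monomials_of: "finite {i. \<exists>\<kappa> \<nu>. monomials_of f i = Some \<kappa> \<and> \<kappa> + \<nu> = \<mu>}"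
proof (rule finite_subset)
  let ?K = "fst ` {p. fst p + snd p = \<mu>}"
  show "{i. \<exists>\<kappa> \<nu>. monomials_of f i = Some \<kappa> \<and> \<kappa> + \<nu> = \<mu>} \<subseteq> to_nat ` (Sigma ?K (\<lambda>\<kappa>. {..<f \<kappa>}))"
  proof safe
    fix i \<kappa> \<nu> assume *: "monomials_of f i = Some \<kappa>" "\<mu> = \<kappa> + \<nu>"
    then obtain k where "k < f \<kappa>" "i = to_nat (\<kappa>, k)"
      unfolding monomials_of_def by (auto split: if_splits)
    moreover have "\<kappa> \<in> fst ` {p. fst p + snd p = \<kappa> + \<nu>}" by (rule image_eqI[of _ _ "(\<kappa>, \<nu>)"]) auto
    ultimately show "i \<in> to_nat ` (Sigma (fst ` {p. fst p + snd p = \<kappa> + \<nu>}) (\<lambda>\<kappa>. {..<f \<kappa>}))" by blast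
  qed
  show "finite (to_nat ` (Sigma ?K (\<lambda>\<kappa>. {..<f \<kappa>})))"
    by (intro finite_imageI finite_SigmaI finite_decomp) auto
qed

text \<open>The plethysm \<open>g \<circ> f = g(y\<^sub>0, y\<^sub>1, \<dots>)\<close>, where \<open>f = y\<^sub>0 + y\<^sub>1 + \<dots>\<close> with monic monomials \<open>y\<^sub>i\<close>.\<close>

lift_definition plethysm :: "sym \<Rightarrow> sym \<Rightarrow> sym" (infixl "\<odot>" 75) is
  "\<lambda>g f. subst g (monomials_of f)"
proof -
  fix g f assume gf: "is_sym g" "is_sym f"
  obtain d e where d: "\<forall>\<gamma>. g \<gamma> \<noteq> 0 \<longrightarrow> size \<gamma> \<le> d" and e: "\<forall>\<gamma>. f \<gamma> \<noteq> 0 \<longrightarrow> size \<gamma> \<le> e"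
    using gf by (auto simp: is_sym_def)
  have "subst g (monomials_of f) (image_mset \<pi> \<mu>) = subst g (monomials_of f) \<mu>"
    if \<pi>: "bij \<pi>" for \<pi> \<mu>
  proof -
    let ?R = "range (to_nat :: nat multiset \<times> nat \<Rightarrow> nat)"
    define \<sigma> where "\<sigma> \<pi> i = (if i \<in> ?R
       then to_nat (map_prod (image_mset \<pi>) id (from_nat i :: nat multiset \<times> nat)) else i)"
      for \<pi> :: "nat \<Rightarrow> nat" and i
    have inv: "\<sigma> (inv \<pi>) \<circ> \<sigma> \<pi> = id" "\<sigma> \<pi> \<circ> \<sigma> (inv \<pi>) = id"
      using \<pi> by (auto simp: fun_eq_iff \<sigma>_def)
    show ?thesis
    proof (rule subst_invariant[where \<sigma> = "\<sigma> \<pi>"])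
      show "bij (\<sigma> \<pi>)" using inv by (rule o_bij)
      show "inj (image_mset \<pi>)" using bij_image_mset[OF \<pi>] by (rule bij_is_inj)
      show "monomials_of f (\<sigma> \<pi> i) = map_option (image_mset \<pi>) (monomials_of f i)" for i
        by (cases "i \<in> ?R") (use \<pi> gf in \<open>auto simp: \<sigma>_def monomials_of_outside is_symD\<close>)
    qed (use gf in auto)
  qed
  moreover have "size \<mu> \<le> d * e" if "subst g (monomials_of f) \<mu> \<noteq> 0" for \<mu>
    by (rule subst_degree[OF d that]) (use e monomials_of_SomeD in auto)
  ultimately show "is_sym (subst g (monomials_of f))" unfolding is_sym_def by blast
qed

section \<open>The tensor square and the coproducts\<close>

text \<open>
  The free module on the symbols \<open>m\<^sub>\<alpha> \<otimes> m\<^sub>\<beta>\<close>, realised as the functions of bounded degree in the two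
  sets of variables \<open>x\<^sub>i \<otimes> 1\<close> and \<open>1 \<otimes> x\<^sub>i\<close> that are symmetric in each set separately.
\<close>

definition is_sym2 :: "(nat multiset \<times> nat multiset \<Rightarrow> nat) \<Rightarrow> bool" where
  "is_sym2 F \<longleftrightarrow>
    (\<forall>\<pi> \<rho>. bij \<pi> \<longrightarrow> bij \<rho> \<longrightarrow> (\<forall>p. F (map_prod (image_mset \<pi>) (image_mset \<rho>) p) = F p))
    \<and> (\<exists>d. \<forall>p. F p \<noteq> 0 \<longrightarrow> size (fst p) + size (snd p) \<le> d)"

typedef sym2 = "{F. is_sym2 F}"
  morphisms coeff2 Abs_sym2
  by (rule exI[of _ "\<lambda>_. 0"]) (auto simp: is_sym2_def)

setup_lifting type_definition_sym2

lift_definition tensor :: "sym \<Rightarrow> sym \<Rightarrow> sym2" is "\<lambda>f g p. f (fst p) * g (snd p)"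
proof -
  fix f g assume fg: "is_sym f" "is_sym g"
  obtain d e where "\<forall>\<gamma>. f \<gamma> \<noteq> 0 \<longrightarrow> size \<gamma> \<le> d" "\<forall>\<gamma>. g \<gamma> \<noteq> 0 \<longrightarrow> size \<gamma> \<le> e"
    using fg by (auto simp: is_sym_def)
  hence "\<forall>p. f (fst p) * g (snd p) \<noteq> 0 \<longrightarrow> size (fst p) + size (snd p) \<le> d + e"
    by (auto intro: add_mono)
  thus "is_sym2 (\<lambda>p. f (fst p) * g (snd p))"
    using fg unfolding is_sym2_def by (auto simp: is_symD)
qed

lemma is_sym2_subst:
  fixes y :: "nat \<Rightarrow> (nat multiset \<times> nat multiset) option"
  assumes f: "is_sym f"
    and y: "\<And>\<pi> \<rho>. bij \<pi> \<Longrightarrow> bij \<rho> \<Longrightarrow> \<exists>\<sigma>. bij \<sigma> \<and>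
          (\<forall>i. y (\<sigma> i) = map_option (map_prod (image_mset \<pi>) (image_mset \<rho>)) (y i))"
    and e: "\<And>i \<kappa>. y i = Some \<kappa> \<Longrightarrow> size (fst \<kappa>) + size (snd \<kappa>) \<le> e"
  shows "is_sym2 (subst f y)"
proof -
  obtain d where d: "\<forall>\<gamma>. f \<gamma> \<noteq> 0 \<longrightarrow> size \<gamma> \<le> d" using f by (auto simp: is_sym_def)
  have "subst f y (map_prod (image_mset \<pi>) (image_mset \<rho>) p) = subst f y p"
    if "bij \<pi>" "bij \<rho>" for \<pi> \<rho> p
  proof -
    from y[OF that] obtain \<sigma> where "bij \<sigma>"
      and "\<And>i. y (\<sigma> i) = map_option (map_prod (image_mset \<pi>) (image_mset \<rho>)) (y i)" by blast
    moreover have "inj (map_prod (image_mset \<pi>) (image_mset \<rho>))"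
      using that by (intro prod.inj_map bij_is_inj bij_image_mset)
    ultimately show ?thesis
      by (intro subst_invariant[OF f, where \<sigma> = \<sigma>]) (auto simp: zero_prod_def plus_prod_def)
  qed
  moreover have "size (fst p) + size (snd p) \<le> d * e" if "subst f y p \<noteq> 0" for p
    by (rule subst_degree[OF d that, of "\<lambda>p. size (fst p) + size (snd p)"]) (use e in auto)
  ultimately show ?thesis unfolding is_sym2_def by blast
qed

text \<open>The families of all \<open>x\<^sub>i \<otimes> 1\<close> and \<open>1 \<otimes> x\<^sub>i\<close>, and of all \<open>x\<^sub>i \<otimes> x\<^sub>j\<close>.\<close>

definition plus_vars :: "nat \<Rightarrow> (nat multiset \<times> nat multiset) option" where
  "plus_vars k = Some (case sum_decode k of Inl i \<Rightarrow> ({#i#}, {#}) | Inr i \<Rightarrow> ({#}, {#i#}))"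

definition times_vars :: "nat \<Rightarrow> (nat multiset \<times> nat multiset) option" where
  "times_vars k = Some (case prod_decode k of (i, j) \<Rightarrow> ({#i#}, {#j#}))"

lift_definition coadd :: "sym \<Rightarrow> sym2" is "\<lambda>f. subst f plus_vars"
proof (rule is_sym2_subst)
  fix \<pi> \<rho> :: "nat \<Rightarrow> nat" assume "bij \<pi>" "bij \<rho>"
  let ?\<sigma> = "sum_encode \<circ> map_sum \<pi> \<rho> \<circ> sum_decode"
  have "bij (map_sum \<pi> \<rho>)"
    by (rule o_bij[of "map_sum (inv \<pi>) (inv \<rho>)"])
       (use \<open>bij \<pi>\<close> \<open>bij \<rho>\<close> in \<open>auto simp: map_sum.comp map_sum.id bij_is_inj bij_is_surj surj_iff[THEN iffD1]\<close>)
  hence "bij ?\<sigma>" by (intro bij_comp bij_sum_encode bij_sum_decode)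
  moreover have "plus_vars (?\<sigma> i) =
      map_option (map_prod (image_mset \<pi>) (image_mset \<rho>)) (plus_vars i)" for i
    by (auto simp: plus_vars_def split: sum.splits)
  ultimately show "\<exists>\<sigma>. bij \<sigma> \<and>
      (\<forall>i. plus_vars (\<sigma> i) = map_option (map_prod (image_mset \<pi>) (image_mset \<rho>)) (plus_vars i))"
    by blast
qed (auto simp: plus_vars_def split: sum.splits)

lift_definition comult :: "sym \<Rightarrow> sym2" is "\<lambda>f. subst f times_vars"
proof (rule is_sym2_subst)
  fix \<pi> \<rho> :: "nat \<Rightarrow> nat" assume "bij \<pi>" "bij \<rho>"
  let ?\<sigma> = "prod_encode \<circ> map_prod \<pi> \<rho> \<circ> prod_decode"
  have "bij (map_prod \<pi> \<rho>)"
    using bij_betw_map_prod[of \<pi> UNIV UNIV \<rho> UNIV UNIV] \<open>bij \<pi>\<close> \<open>bij \<rho>\<close> by simp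
  hence "bij ?\<sigma>" by (intro bij_comp bij_prod_encode bij_prod_decode)
  moreover have "times_vars (?\<sigma> i) =
      map_option (map_prod (image_mset \<pi>) (image_mset \<rho>)) (times_vars i)" for i
    by (auto simp: times_vars_def split: prod.splits)
  ultimately show "\<exists>\<sigma>. bij \<sigma> \<and>
      (\<forall>i. times_vars (\<sigma> i) = map_option (map_prod (image_mset \<pi>) (image_mset \<rho>)) (times_vars i))"
    by blast
qed (auto simp: times_vars_def split: prod.splits)

lemma finite_plus_vars: "finite {i. \<exists>\<kappa> \<nu>. plus_vars i = Some \<kappa> \<and> \<kappa> + \<nu> = \<mu>}"
proof (rule finite_subset)
  show "{i. \<exists>\<kappa> \<nu>. plus_vars i = Some \<kappa> \<and> \<kappa> + \<nu> = \<mu>}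
      \<subseteq> sum_encode ` (Inl ` set_mset (fst \<mu>) \<union> Inr ` set_mset (snd \<mu>))"
  proof
    fix i assume "i \<in> {i. \<exists>\<kappa> \<nu>. plus_vars i = Some \<kappa> \<and> \<kappa> + \<nu> = \<mu>}"
    hence "sum_decode i \<in> Inl ` set_mset (fst \<mu>) \<union> Inr ` set_mset (snd \<mu>)"
      by (auto simp: plus_vars_def split: sum.splits)
    thus "i \<in> sum_encode ` (Inl ` set_mset (fst \<mu>) \<union> Inr ` set_mset (snd \<mu>))"
      by (metis image_eqI sum_decode_inverse)
  qed
qed auto

lemma finite_times_vars: "finite {i. \<exists>\<kappa> \<nu>. times_vars i = Some \<kappa> \<and> \<kappa> + \<nu> = \<mu>}"
proof (rule finite_subset)
  show "{i. \<exists>\<kappa> \<nu>. times_vars i = Some \<kappa> \<and> \<kappa> + \<nu> = \<mu>}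
      \<subseteq> prod_encode ` (set_mset (fst \<mu>) \<times> set_mset (snd \<mu>))"
  proof
    fix i assume "i \<in> {i. \<exists>\<kappa> \<nu>. times_vars i = Some \<kappa> \<and> \<kappa> + \<nu> = \<mu>}"
    hence "prod_decode i \<in> set_mset (fst \<mu>) \<times> set_mset (snd \<mu>)"
      by (auto simp: times_vars_def split: prod.splits)
    thus "i \<in> prod_encode ` (set_mset (fst \<mu>) \<times> set_mset (snd \<mu>))"
      by (metis image_eqI prod_decode_inverse)
  qed
qed auto

section \<open>Witt vectors\<close>

definition semiring_hom :: "('a :: comm_semiring_1 \<Rightarrow> 'b :: comm_semiring_1) \<Rightarrow> bool" where
  "semiring_hom h \<longleftrightarrow> h 0 = 0 \<and> h 1 = 1
    \<and> (\<forall>x y. h (x + y) = h x + h y) \<and> (\<forall>x y. h (x * y) = h x * h y)"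

definition Witt :: "(sym \<Rightarrow> 'a :: comm_semiring_1) set" where
  "Witt = {a. semiring_hom a}"

text \<open>For additive \<open>a\<close> and \<open>b\<close>, this is the additive map on the tensor square that extends
  \<open>f \<otimes> g \<mapsto> a(f) b(g)\<close>, written out in the basis \<open>m\<^sub>\<alpha> \<otimes> m\<^sub>\<beta>\<close>
  (cf. \<open>tensor_eval_tensor\<close> below).\<close>

definition tensor_eval :: "(sym \<Rightarrow> 'a :: comm_semiring_1) \<Rightarrow> (sym \<Rightarrow> 'a) \<Rightarrow> sym2 \<Rightarrow> 'a" where
  "tensor_eval a b F =
    (\<Sum>(\<alpha>, \<beta>) | coeff2 F (part_mono \<alpha>, part_mono \<beta>) \<noteq> 0.
      of_nat (coeff2 F (part_mono \<alpha>, part_mono \<beta>)) * (a (msym \<alpha>) * b (msym \<beta>)))"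

lemma tensor_eval_tensor:
  fixes a b :: "sym \<Rightarrow> 'a :: comm_semiring_1"
  assumes a: "a 0 = 0" "\<And>f g. a (f + g) = a f + a g"
    and b: "b 0 = 0" "\<And>f g. b (f + g) = b f + b g"
  shows "tensor_eval a b (tensor f g) = a f * b g"
proof -
  have "{(\<alpha>, \<beta>). coeff2 (tensor f g) (part_mono \<alpha>, part_mono \<beta>) \<noteq> 0}
      = {\<alpha>. coeff f (part_mono \<alpha>) \<noteq> 0} \<times> {\<beta>. coeff g (part_mono \<beta>) \<noteq> 0}"
    by (auto simp: tensor.rep_eq)
  thus ?thesis
    unfolding tensor_eval_def additive_expand[of a f, OF a] additive_expand[of b g, OF b]
    by (simp add: sum_product sum.cartesian_product tensor.rep_eq ac_simps case_prod_unfold)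
qed

definition witt_plus ::
  "(sym \<Rightarrow> 'a :: comm_semiring_1) \<Rightarrow> (sym \<Rightarrow> 'a) \<Rightarrow> sym \<Rightarrow> 'a" (infixl "+\<^sub>W" 65) where
  "a +\<^sub>W b = (\<lambda>f. tensor_eval a b (coadd f))"

definition witt_times ::
  "(sym \<Rightarrow> 'a :: comm_semiring_1) \<Rightarrow> (sym \<Rightarrow> 'a) \<Rightarrow> sym \<Rightarrow> 'a" (infixl "*\<^sub>W" 70) where
  "a *\<^sub>W b = (\<lambda>f. tensor_eval a b (comult f))"

text \<open>The maps \<open>f \<mapsto> f(0, 0, \<dots>)\<close> and \<open>f \<mapsto> f(1, 0, 0, \<dots>)\<close>; the values are the coefficients of the
  monomial 1 after substituting only 0 and the monomial 1.\<close>

definition witt_zero :: "sym \<Rightarrow> 'a :: comm_semiring_1" ("0\<^sub>W") where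
  "0\<^sub>W = (\<lambda>f. of_nat (subst (coeff f) (\<lambda>_. None) ({#} :: nat multiset)))"

definition witt_one :: "sym \<Rightarrow> 'a :: comm_semiring_1" ("1\<^sub>W") where
  "1\<^sub>W = (\<lambda>f. of_nat (subst (coeff f) (\<lambda>i. if i = 0 then Some {#} else None) ({#} :: nat multiset)))"

definition witt_hom :: "('b :: comm_semiring_1 \<Rightarrow> sym \<Rightarrow> 'a :: comm_semiring_1) \<Rightarrow> bool" where
  "witt_hom h \<longleftrightarrow> range h \<subseteq> Witt \<and> h 0 = 0\<^sub>W \<and> h 1 = 1\<^sub>W
    \<and> (\<forall>x y. h (x + y) = h x +\<^sub>W h y) \<and> (\<forall>x y. h (x * y) = h x *\<^sub>W h y)"

definition witt_act :: "sym \<Rightarrow> (sym \<Rightarrow> 'a :: comm_semiring_1) \<Rightarrow> sym \<Rightarrow> 'a" where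
  "witt_act f a = (\<lambda>g. a (g \<odot> f))"

definition witt_le :: "(sym \<Rightarrow> 'a :: {comm_semiring_1, order}) \<Rightarrow> (sym \<Rightarrow> 'a) \<Rightarrow> bool"
    (infix "\<preceq>\<^sub>W" 50) where
  "a \<preceq>\<^sub>W b \<longleftrightarrow> (\<forall>f. a f \<le> b f)"

section \<open>The Boolean Witt vectors in coordinates\<close>

text \<open>The additive map with \<open>m\<^sub>\<alpha> \<mapsto> \<phi> \<alpha>\<close>.\<close>

definition lin_ext :: "(partition \<Rightarrow> 'a :: comm_semiring_1) \<Rightarrow> sym \<Rightarrow> 'a" where
  "lin_ext \<phi> f = (\<Sum>\<alpha> | coeff f (part_mono \<alpha>) \<noteq> 0. of_nat (coeff f (part_mono \<alpha>)) * \<phi> \<alpha>)"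

lemma lin_ext_msym: "lin_ext \<phi> (msym \<alpha>) = \<phi> \<alpha>"
  by (simp add: lin_ext_def coeff_msym)

lemma lin_ext_add: "lin_ext \<phi> (f + g) = lin_ext \<phi> f + lin_ext \<phi> g"
proof -
  let ?S = "{\<alpha>. coeff f (part_mono \<alpha>) \<noteq> 0} \<union> {\<alpha>. coeff g (part_mono \<alpha>) \<noteq> 0}"
  have "lin_ext \<phi> h = (\<Sum>\<alpha>\<in>?S. of_nat (coeff h (part_mono \<alpha>)) * \<phi> \<alpha>)"
    if "{\<alpha>. coeff h (part_mono \<alpha>) \<noteq> 0} \<subseteq> ?S" for h
    unfolding lin_ext_def
    by (rule sum.mono_neutral_left) (use that in \<open>auto simp: finite_sym_support[simplified]\<close>)
  thus ?thesis by (simp add: plus_sym.rep_eq distrib_right sum.distrib subset_iff)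
qed

datatype coord = Pt nat nat | Infty

fun bwitt :: "coord \<Rightarrow> sym \<Rightarrow> boole" where
  "bwitt (Pt x y) = lin_ext (\<lambda>\<alpha>. if part \<alpha> x \<ge> y + 1 then 0 else 1)"
| "bwitt Infty = lin_ext (\<lambda>\<alpha>. 1)"

end

theory Submission
  imports Defs
begin

text \<open>
  Coefficients in \<open>\<nat>\<close> never cancel, so an additive map from symmetric functions to the Booleans
  is the same thing as a set of accepted monomials, closed under renaming variables: the map is 1 at
  \<open>f\<close> iff some monomial of \<open>f\<close> is accepted.  The point \<open>(x, y)\<close> accepts the monomials in which at
  most \<open>x\<close> variables have an exponent above \<open>y\<close>, and \<open>\<infinity>\<close> accepts every monomial (\<open>bwitt_eq_B1\<close>).
  
  The operations become statements about monomials.  A sum \<open>a + b\<close> accepts a monomial iff its variables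
  can be split into two groups of which \<open>a\<close> accepts the first and \<open>b\<close> the second
  (\<open>witt_plus_eq_B1\<close>).  A product accepts a monomial iff its exponents can be placed at distinct
  positions of a matrix whose row sums are accepted by the first factor and whose column sums are
  accepted by the second (\<open>witt_times_eq_B1\<close>).  The action of \<open>f\<close> substitutes distinct copies of
  monomials of \<open>f\<close> for the variables (\<open>witt_act_eq_B1\<close>).  Sums are then settled by counting large
  exponents on the two sides.  For products and the action with a bound on the exponents, merging
  exponents can only increase them, which gives one direction; for the other, a witness avoids all
  merging, namely a diagonal matrix or monomials of \<open>m\<^sub>\<lambda>\<close> in disjoint variables.
  
  That nothing else is a homomorphism is the substantial part.  Multiplicativity makes the accepted
  partitions an order ideal under containment of diagrams in which any two members have a common upper
  bound, so they are known once the accepted rectangles are (\<open>accepts_iff_rect\<close>).  If a rectangle with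
  \<open>m\<close> rows is accepted and cannot be made taller, then a product of two copies of it has no accepted term
  unless the copies lie on the same \<open>m\<close> variables, and so the wider rectangle is accepted
  (\<open>accepts_rect_square\<close>).  Hence, unless all rectangles are accepted, the accepted ones are those with
  at most \<open>x\<close> rows or at most \<open>y\<close> columns, for some \<open>x\<close> and \<open>y\<close>, and this is \<open>(x, y)\<close>.
  
  The order is tested on rectangles too, and injectivity of the coordinates is its antisymmetry.
\<close>

section \<open>The partition underlying a monomial\<close>

definition shape :: "nat multiset \<Rightarrow> partition" where
  "shape \<gamma> = (SOME \<alpha>. \<exists>\<pi>. bij \<pi> \<and> \<gamma> = image_mset \<pi> (part_mono \<alpha>))"

lemma shape_orbit: "\<exists>\<pi>. bij \<pi> \<and> \<gamma> = image_mset \<pi> (part_mono (shape \<gamma>))"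
  unfolding shape_def by (rule someI_ex) (rule part_mono_orbit_exists)

lemma coeff_shape: "coeff f (part_mono (shape \<gamma>)) = coeff f \<gamma>"
  using shape_orbit[of \<gamma>] is_symD[OF is_sym_coeff] by metis

lemma coeff2_shape: "coeff2 F (part_mono (shape \<gamma>), part_mono (shape \<delta>)) = coeff2 F (\<gamma>, \<delta>)"
proof -
  have sym: "bij \<pi> \<Longrightarrow> bij \<rho> \<Longrightarrow> coeff2 F (map_prod (image_mset \<pi>) (image_mset \<rho>) p) = coeff2 F p" for \<pi> \<rho> p
    using coeff2[of F] by (cases p) (auto simp: is_sym2_def)
  obtain \<pi> \<rho> where "bij \<pi>" "image_mset \<pi> (part_mono (shape \<gamma>)) = \<gamma>"
    "bij \<rho>" "image_mset \<rho> (part_mono (shape \<delta>)) = \<delta>"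
    using shape_orbit by metis
  thus ?thesis using sym[of \<pi> \<rho> "(part_mono (shape \<gamma>), part_mono (shape \<delta>))"] by simp
qed

lemma partition_eqI: "(\<And>k i. k < part \<alpha> i \<longleftrightarrow> k < part \<beta> i) \<Longrightarrow> \<alpha> = \<beta>"
  by (metis ext linorder_neqE_nat less_irrefl part_inject)

lemma less_count_in: "k < count \<gamma> j \<Longrightarrow> j \<in># \<gamma>"
  by (rule count_inI) simp

lemma level_subset: "{j. k < count \<gamma> j} \<subseteq> set_mset \<gamma>"
  by (auto intro: less_count_in)

lemma finite_level: "finite {j. k < count \<gamma> j}"
  using level_subset by (rule finite_subset) simp

text \<open>
  The number of variables with exponent above \<open>k\<close> is column \<open>k\<close> of the diagram of the partition.  These
  numbers therefore determine the partition, and they can be computed without sorting the exponents.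
\<close>

lemma less_part_shape: "k < part (shape \<gamma>) i \<longleftrightarrow> i < card {j. k < count \<gamma> j}"
proof -
  obtain \<pi> where \<pi>: "bij \<pi>" "\<gamma> = image_mset \<pi> (part_mono (shape \<gamma>))"
    using shape_orbit by metis
  hence *: "count \<gamma> (\<pi> i) = part (shape \<gamma>) i" for i
    by (metis count_image_mset_bij count_part_mono)
  have "{j. k < count \<gamma> j} = \<pi> ` {j. k < part (shape \<gamma>) j}"
  proof safe
    fix j assume "k < count \<gamma> j"
    moreover obtain i where "j = \<pi> i" using \<pi>(1) by (metis bij_pointE)
    ultimately show "j \<in> \<pi> ` {i. k < part (shape \<gamma>) i}" using * by auto
  qed (simp add: *)
  hence "card {j. k < count \<gamma> j} = card {j. k < part (shape \<gamma>) j}"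
    using \<pi>(1) by (metis bij_is_inj card_image inj_on_subset subset_UNIV)
  thus ?thesis using part_level[of k "shape \<gamma>"] by auto
qed

lemma shape_part_mono: "shape (part_mono \<alpha>) = \<alpha>"
proof (rule partition_eqI)
  fix k i
  show "k < part (shape (part_mono \<alpha>)) i \<longleftrightarrow> k < part \<alpha> i"
    using part_level[of k \<alpha>] by (auto simp: less_part_shape)
qed

lemma coeff_msym_shape: "coeff (msym \<alpha>) \<gamma> = (if shape \<gamma> = \<alpha> then 1 else 0)"
  using coeff_shape[of "msym \<alpha>" \<gamma>] by (auto simp: coeff_msym)

lemma count_image_mset_inj_on:
  assumes "inj_on g (set_mset \<gamma>)" "i \<in># \<gamma>"
  shows "count (image_mset g \<gamma>) (g i) = count \<gamma> i"
proof -
  have "{j. j \<in># \<gamma> \<and> g i = g j} = {i}" using assms by (auto simp: inj_on_def)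
  thus ?thesis by (simp add: count_image_mset')
qed

lemma count_image_mset_inj: "inj g \<Longrightarrow> count (image_mset g \<gamma>) (g i) = count \<gamma> i"
proof -
  assume "inj g"
  hence "{j. j \<in># \<gamma> \<and> g i = g j} = (if i \<in># \<gamma> then {i} else {})" by (auto simp: inj_eq)
  thus ?thesis by (simp add: count_image_mset' not_in_iff)
qed

text \<open>
  Since the renaming need only be injective on the variables that occur, a monomial may be moved to
  any convenient set of variables.
\<close>

lemma shape_relabel:
  assumes g: "inj_on g (set_mset \<gamma>)"
  shows "shape (image_mset g \<gamma>) = shape \<gamma>"
proof (rule partition_eqI)
  fix k i
  have "{j. k < count (image_mset g \<gamma>) j} = g ` {j. k < count \<gamma> j}"
  proof safe
    fix j assume j: "k < count (image_mset g \<gamma>) j"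
    hence "j \<in># image_mset g \<gamma>" by (rule less_count_in)
    then obtain l where "l \<in># \<gamma>" "j = g l" by auto
    thus "j \<in> g ` {j. k < count \<gamma> j}" using j count_image_mset_inj_on[OF g] by auto
  next
    fix j assume j: "k < count \<gamma> j"
    hence "j \<in># \<gamma>" by (rule less_count_in)
    thus "k < count (image_mset g \<gamma>) (g j)" using j count_image_mset_inj_on[OF g] by auto
  qed
  moreover have "inj_on g {j. k < count \<gamma> j}"
    by (rule inj_on_subset[OF g level_subset])
  ultimately show "k < part (shape (image_mset g \<gamma>)) i \<longleftrightarrow> k < part (shape \<gamma>) i"
    by (simp add: less_part_shape card_image)
qed

lemma coeff_cong_shape: "shape \<gamma> = shape \<delta> \<Longrightarrow> coeff f \<gamma> = coeff f \<delta>"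
  by (metis coeff_shape)

lemma shape_mono: "\<gamma> \<subseteq># \<delta> \<Longrightarrow> part (shape \<gamma>) i \<le> part (shape \<delta>) i"
proof (rule ccontr)
  assume sub: "\<gamma> \<subseteq># \<delta>" and "\<not> part (shape \<gamma>) i \<le> part (shape \<delta>) i"
  hence "i < card {j. part (shape \<delta>) i < count \<gamma> j}" by (simp flip: less_part_shape)
  also have "\<dots> \<le> card {j. part (shape \<delta>) i < count \<delta> j}"
    using sub by (intro card_mono finite_level Collect_mono) (meson less_le_trans mset_subset_eq_count)
  finally have "part (shape \<delta>) i < part (shape \<delta>) i" by (simp only: less_part_shape)
  thus False by simp
qed

lemma part_mono_subset:
  assumes "\<And>i. part \<alpha> i \<le> part \<beta> i"
  shows "part_mono \<alpha> \<subseteq># part_mono \<beta>"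
  by (rule mset_subset_eqI) (simp add: assms)

lemma part_eq_0: "\<exists>N. \<forall>n\<ge>N. part \<alpha> n = 0"
  using part[of \<alpha>] by simp

section \<open>Evaluation of additive maps to the Boolean semiring\<close>

lemma boole_eqI: "(a = B1 \<longleftrightarrow> b = B1) \<Longrightarrow> a = b"
  by (cases a; cases b) auto

lemma boole_add: "a + b = B1 \<longleftrightarrow> a = B1 \<or> b = B1"
  by (cases a; cases b) (auto simp: zero_boole_def one_boole_def)

lemma boole_mult: "a * b = B1 \<longleftrightarrow> a = B1 \<and> b = B1"
  by (cases a; cases b) (auto simp: zero_boole_def one_boole_def)

lemma boole_sum: "finite A \<Longrightarrow> sum g A = B1 \<longleftrightarrow> (\<exists>x\<in>A. g x = B1)"
  by (induction A rule: finite_induct) (auto simp: boole_add zero_boole_def)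

lemma boole_of_nat: "of_nat n = B1 \<longleftrightarrow> n \<noteq> 0"
  by (induction n) (auto simp: boole_add zero_boole_def one_boole_def)

lemma additive_eq_B1:
  assumes "a 0 = 0" "\<And>f g. a (f + g) = a f + a g"
  shows "a f = B1 \<longleftrightarrow> (\<exists>\<gamma>. coeff f \<gamma> \<noteq> 0 \<and> a (msym (shape \<gamma>)) = B1)"
proof -
  have "a f = B1 \<longleftrightarrow> (\<exists>\<alpha>. coeff f (part_mono \<alpha>) \<noteq> 0 \<and> a (msym \<alpha>) = B1)"
    by (subst additive_expand[of a f, OF assms], subst boole_sum[OF finite_sym_support])
       (simp only: boole_mult boole_of_nat, auto)
  thus ?thesis by (metis coeff_shape shape_part_mono)
qed

text \<open>
  The truncation of \<open>\<Sum>\<^sub>\<lambda> m\<^sub>\<lambda>\<close> to degree at most \<open>d\<close> is itself a symmetric function, and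
  symmetric functions have finite support.
\<close>

lemma finite_partitions_size_le: "finite {\<alpha>. size (part_mono \<alpha>) \<le> d}"
proof -
  let ?f = "\<lambda>\<gamma> :: nat multiset. if size \<gamma> \<le> d then 1 else 0 :: nat"
  have "is_sym ?f" by (auto simp: is_sym_def)
  hence "coeff (Abs_sym ?f) = ?f" by (simp add: Abs_sym_inverse)
  hence "{\<alpha>. size (part_mono \<alpha>) \<le> d} = {\<alpha>. coeff (Abs_sym ?f) (part_mono \<alpha>) \<noteq> 0}" by simp
  thus ?thesis by (simp only: finite_sym_support)
qed

lemma tensor_eval_eq_B1:
  "tensor_eval a b F = B1 \<longleftrightarrow>
    (\<exists>\<gamma> \<delta>. coeff2 F (\<gamma>, \<delta>) \<noteq> 0 \<and> a (msym (shape \<gamma>)) = B1 \<and> b (msym (shape \<delta>)) = B1)"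
proof -
  obtain d where d: "\<forall>p. coeff2 F p \<noteq> 0 \<longrightarrow> size (fst p) + size (snd p) \<le> d"
    using coeff2[of F] by (auto simp: is_sym2_def)
  let ?S = "{(\<alpha>, \<beta>). coeff2 F (part_mono \<alpha>, part_mono \<beta>) \<noteq> 0}"
  have "?S \<subseteq> {\<alpha>. size (part_mono \<alpha>) \<le> d} \<times> {\<alpha>. size (part_mono \<alpha>) \<le> d}"
    using d by fastforce
  hence "finite ?S" by (rule finite_subset) (simp add: finite_partitions_size_le)
  hence "tensor_eval a b F = B1 \<longleftrightarrow>
      (\<exists>\<alpha> \<beta>. coeff2 F (part_mono \<alpha>, part_mono \<beta>) \<noteq> 0 \<and> a (msym \<alpha>) = B1 \<and> b (msym \<beta>) = B1)"
    unfolding tensor_eval_def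
    by (subst boole_sum) (simp_all only: boole_mult boole_of_nat split_beta, auto)
  thus ?thesis by (metis coeff2_shape shape_part_mono)
qed

text \<open>
  The monomials accepted by the Witt vector with the given coordinates, described without reference
  to the underlying partition.
\<close>

fun admits :: "coord \<Rightarrow> nat multiset \<Rightarrow> bool" where
  "admits (Pt x y) \<gamma> \<longleftrightarrow> card {j. y < count \<gamma> j} \<le> x"
| "admits Infty \<gamma> \<longleftrightarrow> True"

lemma admits_shape: "bwitt c (msym (shape \<gamma>)) = B1 \<longleftrightarrow> admits c \<gamma>"
  using less_part_shape[where \<gamma> = \<gamma>] by (cases c) (auto simp: lin_ext_msym Suc_le_eq not_less zero_boole_def one_boole_def)

lemma admits_relabel: "inj_on g (set_mset \<gamma>) \<Longrightarrow> admits c (image_mset g \<gamma>) \<longleftrightarrow> admits c \<gamma>"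
  by (metis admits_shape shape_relabel)

lemma bwitt_0: "bwitt c 0 = 0"
  by (cases c) (simp_all add: lin_ext_def zero_sym.rep_eq)

lemma bwitt_add: "bwitt c (f + g) = bwitt c f + bwitt c g"
  by (cases c) (simp_all add: lin_ext_add)

lemma bwitt_eq_B1: "bwitt c f = B1 \<longleftrightarrow> (\<exists>\<gamma>. coeff f \<gamma> \<noteq> 0 \<and> admits c \<gamma>)"
  by (subst additive_eq_B1) (simp_all only: bwitt_0 bwitt_add admits_shape)

lemma coeff_mult_nonzero:
  "coeff (f * g) \<mu> \<noteq> 0 \<longleftrightarrow> (\<exists>\<gamma> \<delta>. \<gamma> + \<delta> = \<mu> \<and> coeff f \<gamma> \<noteq> 0 \<and> coeff g \<delta> \<noteq> 0)"
  by (auto simp: times_sym.rep_eq finite_decomp)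


section \<open>The semiring operations on monomials\<close>

lemma subst_nonzero:
  fixes y :: "nat \<Rightarrow> 'm :: comm_monoid_add option"
  assumes "is_sym f" "finite {i. \<exists>\<kappa> \<nu>. y i = Some \<kappa> \<and> \<kappa> + \<nu> = \<mu>}"
  shows "subst f y \<mu> \<noteq> 0 \<longleftrightarrow>
    (\<exists>\<gamma>. f \<gamma> \<noteq> 0 \<and> (\<forall>i\<in>#\<gamma>. y i \<noteq> None) \<and> (\<Sum>i\<in>#\<gamma>. the (y i)) = \<mu>)"
  unfolding subst_def using finite_subst[OF assms] by (subst sum_eq_0_iff) auto

abbreviation left_var :: "nat \<Rightarrow> nat" where "left_var i \<equiv> sum_encode (Inl i)"
abbreviation right_var :: "nat \<Rightarrow> nat" where "right_var i \<equiv> sum_encode (Inr i)"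

lemma sum_plus_vars:
  "(\<Sum>i\<in>#image_mset left_var \<gamma> + image_mset right_var \<delta>. the (plus_vars i)) = (\<gamma>, \<delta>)"
proof -
  have "(\<Sum>i\<in>#image_mset left_var \<gamma>. the (plus_vars i)) = (\<gamma>, {#})"
    by (induction \<gamma>) (auto simp: plus_vars_def zero_prod_def)
  moreover have "(\<Sum>i\<in>#image_mset right_var \<delta>. the (plus_vars i)) = ({#}, \<delta>)"
    by (induction \<delta>) (auto simp: plus_vars_def zero_prod_def)
  ultimately show ?thesis by simp
qed

text \<open>
  A monomial in one set of variables, indexed through the bijection \<open>\<nat> + \<nat> \<cong> \<nat>\<close>, is a pair of
  monomials in two sets of variables.
\<close>

lemma decompose_plus: "\<exists>\<gamma> \<delta>. \<epsilon> = image_mset left_var \<gamma> + image_mset right_var \<delta>"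
proof (induction \<epsilon>)
  case empty
  show ?case by (intro exI[of _ "{#}"]) simp
next
  case (add k \<epsilon>)
  then obtain \<gamma> \<delta> where *: "\<epsilon> = image_mset left_var \<gamma> + image_mset right_var \<delta>" by blast
  show ?case
  proof (cases "sum_decode k")
    case (Inl i)
    hence "k = left_var i" by (metis sum_decode_inverse)
    thus ?thesis using * by (intro exI[of _ "add_mset i \<gamma>"] exI[of _ \<delta>]) simp
  next
    case (Inr i)
    hence "k = right_var i" by (metis sum_decode_inverse)
    thus ?thesis using * by (intro exI[of _ \<gamma>] exI[of _ "add_mset i \<delta>"]) simp
  qed
qed

lemma coeff2_coadd_nonzero:
  "coeff2 (coadd f) (\<gamma>, \<delta>) \<noteq> 0 \<longleftrightarrow> coeff f (image_mset left_var \<gamma> + image_mset right_var \<delta>) \<noteq> 0"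
    (is "?l \<longleftrightarrow> ?r")
proof -
  have "?l \<longleftrightarrow> (\<exists>\<epsilon>. coeff f \<epsilon> \<noteq> 0 \<and> (\<Sum>i\<in>#\<epsilon>. the (plus_vars i)) = (\<gamma>, \<delta>))"
    unfolding coadd.rep_eq
    by (subst subst_nonzero[OF is_sym_coeff finite_plus_vars]) (simp add: plus_vars_def)
  also have "\<dots> \<longleftrightarrow> ?r" by (metis decompose_plus prod.inject sum_plus_vars)
  finally show ?thesis .
qed

lemma shape_disjoint_sum:
  assumes "set_mset \<gamma> \<inter> set_mset \<delta> = {}"
  shows "shape (image_mset left_var \<gamma> + image_mset right_var \<delta>) = shape (\<gamma> + \<delta>)"
proof -
  let ?g = "\<lambda>i. if i \<in># \<gamma> then left_var i else right_var i"
  have "inj_on ?g (set_mset (\<gamma> + \<delta>))" by (auto simp: inj_on_def sum_encode_eq)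
  hence "shape (image_mset ?g (\<gamma> + \<delta>)) = shape (\<gamma> + \<delta>)" by (rule shape_relabel)
  moreover have "image_mset ?g \<gamma> = image_mset left_var \<gamma>" by (rule image_mset_cong) simp
  moreover have "image_mset ?g \<delta> = image_mset right_var \<delta>"
    by (rule image_mset_cong) (use assms in auto)
  ultimately show ?thesis by simp
qed

text \<open>
  The encoding of the two sets of variables has disappeared: two monomials in disjoint variables can be
  renamed into the two halves of the encoding without changing the partition of their product.
\<close>

lemma witt_plus_eq_B1:
  "(bwitt c +\<^sub>W bwitt d) f = B1 \<longleftrightarrow>
    (\<exists>\<gamma> \<delta>. coeff f (\<gamma> + \<delta>) \<noteq> 0 \<and> set_mset \<gamma> \<inter> set_mset \<delta> = {} \<and> admits c \<gamma> \<and> admits d \<delta>)"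
    (is "_ \<longleftrightarrow> ?r")
proof -
  have "(bwitt c +\<^sub>W bwitt d) f = B1 \<longleftrightarrow> (\<exists>\<gamma> \<delta>.
      coeff f (image_mset left_var \<gamma> + image_mset right_var \<delta>) \<noteq> 0 \<and> admits c \<gamma> \<and> admits d \<delta>)"
    (is "_ \<longleftrightarrow> ?m")
    by (simp only: witt_plus_def tensor_eval_eq_B1 coeff2_coadd_nonzero admits_shape)
  moreover have "?m \<longleftrightarrow> ?r"
  proof
    assume ?m
    then obtain \<gamma> \<delta> where *: "coeff f (image_mset left_var \<gamma> + image_mset right_var \<delta>) \<noteq> 0"
      "admits c \<gamma>" "admits d \<delta>" by blast
    have "inj_on left_var (set_mset \<gamma>)" "inj_on right_var (set_mset \<delta>)"
      by (auto simp: inj_on_def sum_encode_eq)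
    hence "admits c (image_mset left_var \<gamma>)" "admits d (image_mset right_var \<delta>)"
      using * by (simp_all only: admits_relabel)
    moreover have "set_mset (image_mset left_var \<gamma>) \<inter> set_mset (image_mset right_var \<delta>) = {}"
      by (auto simp: sum_encode_eq)
    ultimately show ?r using *(1) by blast
  qed (metis shape_disjoint_sum coeff_cong_shape)
  ultimately show ?thesis by simp
qed

lemma sum_times_vars:
  "(\<Sum>i\<in>#image_mset prod_encode M. the (times_vars i)) = (image_mset fst M, image_mset snd M)"
  by (induction M) (auto simp: times_vars_def zero_prod_def)

lemma coeff2_comult_nonzero:
  "coeff2 (comult f) (\<gamma>, \<delta>) \<noteq> 0 \<longleftrightarrow>
    (\<exists>M. coeff f (image_mset prod_encode M) \<noteq> 0 \<and> image_mset fst M = \<gamma> \<and> image_mset snd M = \<delta>)"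
    (is "?l \<longleftrightarrow> ?r")
proof -
  have "\<exists>M. \<epsilon> = image_mset prod_encode M" for \<epsilon>
    by (rule exI[of _ "image_mset prod_decode \<epsilon>"]) (simp add: multiset.map_comp o_def)
  moreover have "?l \<longleftrightarrow> (\<exists>\<epsilon>. coeff f \<epsilon> \<noteq> 0 \<and> (\<Sum>i\<in>#\<epsilon>. the (times_vars i)) = (\<gamma>, \<delta>))"
    unfolding comult.rep_eq
    by (subst subst_nonzero[OF is_sym_coeff finite_times_vars]) (simp add: times_vars_def)
  ultimately show ?thesis by (metis prod.inject sum_times_vars)
qed

text \<open>
  The multiset \<open>M\<close> is a matrix of exponents with finitely many nonzero entries; its two images are its
  row and column sums.
\<close>

lemma witt_times_eq_B1:
  "(bwitt c *\<^sub>W bwitt d) f = B1 \<longleftrightarrow>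
    (\<exists>M. coeff f (image_mset prod_encode M) \<noteq> 0 \<and> admits c (image_mset fst M) \<and> admits d (image_mset snd M))"
  by (simp only: witt_times_def tensor_eval_eq_B1 coeff2_comult_nonzero admits_shape) blast

text \<open>
  Placing the variable \<open>i\<close> of a monomial at the matrix position \<open>(g i, h i)\<close> shows that a product accepts
  it.  With \<open>g = h = id\<close> the matrix is diagonal, and the row and column sums are the exponents themselves.
\<close>

lemma witt_times_B1I:
  assumes "coeff f \<epsilon> \<noteq> 0" and inj: "inj_on (\<lambda>i. (g i, h i)) (set_mset \<epsilon>)"
    and "admits c (image_mset g \<epsilon>)" "admits d (image_mset h \<epsilon>)"
  shows "(bwitt c *\<^sub>W bwitt d) f = B1"
proof -
  let ?M = "image_mset (\<lambda>i. (g i, h i)) \<epsilon>"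
  have "inj_on (\<lambda>i. prod_encode (g i, h i)) (set_mset \<epsilon>)"
    using inj by (auto simp: inj_on_def)
  hence "shape (image_mset prod_encode ?M) = shape \<epsilon>"
    by (simp add: multiset.map_comp o_def shape_relabel)
  hence "coeff f (image_mset prod_encode ?M) \<noteq> 0" using assms(1) by (metis coeff_shape)
  thus ?thesis unfolding witt_times_eq_B1 using assms
    by (intro exI[of _ ?M]) (simp add: multiset.map_comp o_def)
qed

lemma admits_0_left: "admits (Pt 0 y) \<gamma> \<longleftrightarrow> (\<forall>j. count \<gamma> j \<le> y)"
  by (auto simp: finite_level not_less)

lemma admits_0_right: "admits (Pt x 0) \<gamma> \<longleftrightarrow> card (set_mset \<gamma>) \<le> x"
  by simp

lemma admits_empty: "admits c {#}"
  by (cases c) auto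

lemma count_le_count_image: "count M p \<le> count (image_mset f M) (f p)"
  by (induction M) auto

lemma count_sum_mset_ge: "count \<gamma> i * count (h i) j \<le> count (\<Sum>i\<in>#\<gamma>. h i) j"
  by (induction \<gamma>) auto

text \<open>
  The sums \<open>(x, 0) + (x', 0)\<close>, \<open>(x, 0) + (0, y)\<close> and \<open>(0, y) + (0, y')\<close> are special cases.  In a split
  monomial the exponents above \<open>max y y'\<close> number at most \<open>x\<close> on the left and \<open>x'\<close> on the right.
  Conversely, distribute the at most \<open>x + x'\<close> large exponents over the two sides as the bounds \<open>x\<close> and
  \<open>x'\<close> permit, and put all others on the side that tolerates exponents up to \<open>max y y'\<close>.
\<close>

lemma witt_plus_Pt: "bwitt (Pt x y) +\<^sub>W bwitt (Pt x' y') = bwitt (Pt (x + x') (max y y'))"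
proof (rule ext, rule boole_eqI, rule iffI)
  fix f assume "(bwitt (Pt x y) +\<^sub>W bwitt (Pt x' y')) f = B1"
  then obtain \<gamma> \<delta> where nz: "coeff f (\<gamma> + \<delta>) \<noteq> 0" and disj: "set_mset \<gamma> \<inter> set_mset \<delta> = {}"
    and *: "admits (Pt x y) \<gamma>" "admits (Pt x' y') \<delta>"
    unfolding witt_plus_eq_B1 by blast
  have "{j. max y y' < count (\<gamma> + \<delta>) j} \<subseteq> {j. y < count \<gamma> j} \<union> {j. y' < count \<delta> j}"
  proof
    fix j assume j: "j \<in> {j. max y y' < count (\<gamma> + \<delta>) j}"
    have "j \<notin># \<gamma> \<or> j \<notin># \<delta>" using disj by blast
    thus "j \<in> {j. y < count \<gamma> j} \<union> {j. y' < count \<delta> j}" using j by (auto simp: not_in_iff)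
  qed
  hence "card {j. max y y' < count (\<gamma> + \<delta>) j} \<le> card ({j. y < count \<gamma> j} \<union> {j. y' < count \<delta> j})"
    by (rule card_mono[rotated]) (simp add: finite_level)
  also have "\<dots> \<le> card {j. y < count \<gamma> j} + card {j. y' < count \<delta> j}" by (rule card_Un_le)
  also have "\<dots> \<le> x + x'" using * by (intro add_mono) simp_all
  finally have "admits (Pt (x + x') (max y y')) (\<gamma> + \<delta>)" by simp
  thus "bwitt (Pt (x + x') (max y y')) f = B1" using nz unfolding bwitt_eq_B1 by blast
next
  fix f assume "bwitt (Pt (x + x') (max y y')) f = B1"
  then obtain \<epsilon> where nz: "coeff f \<epsilon> \<noteq> 0" and "admits (Pt (x + x') (max y y')) \<epsilon>"
    unfolding bwitt_eq_B1 by blast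
  define B where "B = {j. max y y' < count \<epsilon> j}"
  have B: "finite B" "card B \<le> x + x'"
    using \<open>admits _ \<epsilon>\<close> by (simp_all add: B_def finite_level)
  \<comment> \<open>\<open>B\<close> collects the large exponents, and \<open>B'\<close> those of them that go to the left.\<close>
  obtain B' where B': "B' \<subseteq> B" "card B' = min x (card B)"
    by (metis min.cobounded2 obtain_subset_with_card_n)
  have card: "card B' \<le> x" "card (B - B') \<le> x'"
    using B B' by (auto simp: card_Diff_subset finite_subset[OF B'(1)])
  define A where "A = (if y' \<le> y then - (B - B') else B')"
  let ?\<gamma> = "filter_mset (\<lambda>i. i \<in> A) \<epsilon>" and ?\<delta> = "filter_mset (\<lambda>i. i \<notin> A) \<epsilon>"
  have "{j. y < count ?\<gamma> j} \<subseteq> B'" "{j. y' < count ?\<delta> j} \<subseteq> B - B'"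
    using B'(1) by (auto simp: A_def B_def split: if_splits)
  hence "card {j. y < count ?\<gamma> j} \<le> card B'" "card {j. y' < count ?\<delta> j} \<le> card (B - B')"
    using B(1) B'(1) by (meson card_mono finite_Diff finite_subset)+
  hence "admits (Pt x y) ?\<gamma>" "admits (Pt x' y') ?\<delta>" using card by auto
  moreover have "?\<gamma> + ?\<delta> = \<epsilon>" by (metis multiset_partition)
  moreover have "set_mset ?\<gamma> \<inter> set_mset ?\<delta> = {}" by auto
  ultimately show "(bwitt (Pt x y) +\<^sub>W bwitt (Pt x' y')) f = B1"
    unfolding witt_plus_eq_B1 using nz by metis
qed

text \<open>
  Put the whole monomial on the left; the empty monomial on the right is accepted by every Witt vector.
\<close>

lemma witt_plus_Infty: "bwitt Infty +\<^sub>W bwitt c = bwitt Infty"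
proof (rule ext, rule boole_eqI, rule iffI)
  fix f assume "bwitt Infty f = B1"
  then obtain \<epsilon> where "coeff f \<epsilon> \<noteq> 0" unfolding bwitt_eq_B1 by blast
  thus "(bwitt Infty +\<^sub>W bwitt c) f = B1" unfolding witt_plus_eq_B1
    by (intro exI[of _ \<epsilon>] exI[of _ "{#}"]) (simp add: admits_empty)
qed (auto simp: witt_plus_eq_B1 bwitt_eq_B1 simp del: bwitt.simps)

lemma count_encoded: "count (image_mset prod_encode M) j = count M (prod_decode j)"
  using count_image_mset_inj[of prod_encode M "prod_decode j"] by (simp add: inj_on_def)

text \<open>
  Matrix entries are at most the row and column sums, and a diagonal matrix attains equality.
\<close>

lemma witt_times_bounded: "bwitt (Pt 0 y) *\<^sub>W bwitt (Pt 0 y') = bwitt (Pt 0 (min y y'))"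
proof (rule ext, rule boole_eqI, rule iffI)
  fix f assume "(bwitt (Pt 0 y) *\<^sub>W bwitt (Pt 0 y')) f = B1"
  then obtain M where M: "coeff f (image_mset prod_encode M) \<noteq> 0"
    "\<And>j. count (image_mset fst M) j \<le> y" "\<And>j. count (image_mset snd M) j \<le> y'"
    unfolding witt_times_eq_B1 admits_0_left by blast
  have "count M p \<le> min y y'" for p
    using M(2,3) count_le_count_image by (metis le_trans min.boundedI)
  hence "admits (Pt 0 (min y y')) (image_mset prod_encode M)"
    unfolding admits_0_left count_encoded by blast
  thus "bwitt (Pt 0 (min y y')) f = B1" using M(1) unfolding bwitt_eq_B1 by blast
next
  fix f assume "bwitt (Pt 0 (min y y')) f = B1"
  then obtain \<epsilon> where "coeff f \<epsilon> \<noteq> 0" "admits (Pt 0 (min y y')) \<epsilon>"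
    unfolding bwitt_eq_B1 by blast
  thus "(bwitt (Pt 0 y) *\<^sub>W bwitt (Pt 0 y')) f = B1"
    by (intro witt_times_B1I[of f \<epsilon> id id]) (auto simp: admits_0_left inj_on_def simp del: admits.simps)
qed

lemma witt_times_Infty_bounded: "bwitt Infty *\<^sub>W bwitt (Pt 0 y) = bwitt (Pt 0 y)"
proof (rule ext, rule boole_eqI, rule iffI)
  fix f assume "(bwitt Infty *\<^sub>W bwitt (Pt 0 y)) f = B1"
  then obtain M where M: "coeff f (image_mset prod_encode M) \<noteq> 0"
    "\<And>j. count (image_mset snd M) j \<le> y"
    unfolding witt_times_eq_B1 admits_0_left by blast
  have "count M p \<le> y" for p
    using M(2) count_le_count_image by (metis le_trans)
  hence "admits (Pt 0 y) (image_mset prod_encode M)"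
    unfolding admits_0_left count_encoded by blast
  thus "bwitt (Pt 0 y) f = B1" using M(1) unfolding bwitt_eq_B1 by blast
next
  fix f assume "bwitt (Pt 0 y) f = B1"
  then obtain \<epsilon> where "coeff f \<epsilon> \<noteq> 0" "admits (Pt 0 y) \<epsilon>"
    unfolding bwitt_eq_B1 by blast
  thus "(bwitt Infty *\<^sub>W bwitt (Pt 0 y)) f = B1"
    by (intro witt_times_B1I[of f \<epsilon> id id]) (auto simp: admits_0_left inj_on_def)
qed

lemma witt_times_Infty_Infty: "bwitt Infty *\<^sub>W bwitt Infty = bwitt Infty"
proof (rule ext, rule boole_eqI, rule iffI)
  fix f assume "bwitt Infty f = B1"
  then obtain \<epsilon> where "coeff f \<epsilon> \<noteq> 0" unfolding bwitt_eq_B1 by blast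
  thus "(bwitt Infty *\<^sub>W bwitt Infty) f = B1"
    by (intro witt_times_B1I[of f \<epsilon> id id]) (auto simp: inj_on_def)
qed (auto simp: witt_times_eq_B1 bwitt_eq_B1 simp del: bwitt.simps)

text \<open>
  A matrix with at most \<open>x\<close> nonzero rows and \<open>x'\<close> nonzero columns has at most \<open>x x'\<close> nonzero entries, and
  so many exponents can be spread over an \<open>x \<times> x'\<close> grid.
\<close>

lemma witt_times_nat: "bwitt (Pt x 0) *\<^sub>W bwitt (Pt x' 0) = bwitt (Pt (x * x') 0)"
proof (rule ext, rule boole_eqI, rule iffI)
  fix f assume "(bwitt (Pt x 0) *\<^sub>W bwitt (Pt x' 0)) f = B1"
  then obtain M where M: "coeff f (image_mset prod_encode M) \<noteq> 0"
    "card (fst ` set_mset M) \<le> x" "card (snd ` set_mset M) \<le> x'"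
    unfolding witt_times_eq_B1 admits_0_right set_image_mset by blast
  have "card (set_mset (image_mset prod_encode M)) \<le> card (set_mset M)"
    by (simp add: card_image_le)
  also have "\<dots> \<le> card (fst ` set_mset M \<times> snd ` set_mset M)"
    by (rule card_mono) (auto intro: rev_image_eqI)
  also have "\<dots> \<le> x * x'" using M by (simp add: card_cartesian_product mult_le_mono)
  finally show "bwitt (Pt (x * x') 0) f = B1"
    using M(1) unfolding bwitt_eq_B1 admits_0_right by blast
next
  fix f assume "bwitt (Pt (x * x') 0) f = B1"
  then obtain \<epsilon> where \<epsilon>: "coeff f \<epsilon> \<noteq> 0" "card (set_mset \<epsilon>) \<le> card ({..<x} \<times> {..<x'})"
    unfolding bwitt_eq_B1 admits_0_right by (auto simp: card_cartesian_product)
  then obtain p where p: "p ` set_mset \<epsilon> \<subseteq> {..<x} \<times> {..<x'}" "inj_on p (set_mset \<epsilon>)"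
    using card_le_inj[of "set_mset \<epsilon>" "{..<x} \<times> {..<x'}"] by auto
  have "card ((fst \<circ> p) ` set_mset \<epsilon>) \<le> card {..<x}" "card ((snd \<circ> p) ` set_mset \<epsilon>) \<le> card {..<x'}"
    using p(1) by (intro card_mono; force)+
  thus "(bwitt (Pt x 0) *\<^sub>W bwitt (Pt x' 0)) f = B1"
    using p(2) by (intro witt_times_B1I[OF \<epsilon>(1), of "fst \<circ> p" "snd \<circ> p"])
      (simp_all only: admits_0_right set_image_mset card_lessThan o_apply prod.collapse)
qed

lemma witt_zero_eq: "0\<^sub>W = bwitt (Pt 0 0)"
proof (rule ext, rule boole_eqI)
  fix f
  have "(0\<^sub>W f = B1) = (\<exists>\<gamma>. coeff f \<gamma> \<noteq> 0 \<and> (\<forall>i\<in>#\<gamma>. False))"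
    unfolding witt_zero_def boole_of_nat by (subst subst_nonzero) auto
  also have "\<dots> = (bwitt (Pt 0 0) f = B1)" unfolding bwitt_eq_B1 admits_0_right by auto
  finally show "(0\<^sub>W f = B1) = (bwitt (Pt 0 0) f = B1)" .
qed

text \<open>
  Both sides ask whether \<open>f\<close> contains a power of a single variable.
\<close>

lemma witt_one_eq: "1\<^sub>W = bwitt (Pt 1 0)"
proof (rule ext, rule boole_eqI, rule iffI)
  let ?y = "\<lambda>i. if i = 0 then Some {#} else (None :: nat multiset option)"
  have fin: "finite {i :: nat. \<exists>\<kappa> \<nu>. ?y i = Some \<kappa> \<and> \<kappa> + \<nu> = {#}}"
    by (rule finite_subset[of _ "{0}"]) (auto split: if_splits)
  fix f
  have "1\<^sub>W f = B1 \<longleftrightarrow> (\<exists>\<gamma>. coeff f \<gamma> \<noteq> 0 \<and> (\<forall>i\<in>#\<gamma>. ?y i \<noteq> None) \<and> (\<Sum>i\<in>#\<gamma>. the (?y i)) = {#})"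
    unfolding witt_one_def boole_of_nat by (rule subst_nonzero[OF is_sym_coeff fin])
  moreover have "(\<forall>i\<in>#\<gamma>. ?y i \<noteq> None) \<longleftrightarrow> set_mset \<gamma> \<subseteq> {0}" for \<gamma>
    by (auto split: if_splits)
  moreover have "(\<Sum>i\<in>#\<gamma>. the (?y i)) = {#}" if "set_mset \<gamma> \<subseteq> {0}" for \<gamma>
    using that by (induction \<gamma>) auto
  ultimately have one: "1\<^sub>W f = B1 \<longleftrightarrow> (\<exists>\<gamma>. coeff f \<gamma> \<noteq> 0 \<and> set_mset \<gamma> \<subseteq> {0})"
    by (simp only:) blast
  {
    assume "1\<^sub>W f = B1"
    then obtain \<gamma> where "coeff f \<gamma> \<noteq> 0" "set_mset \<gamma> \<subseteq> {0}" using one by blast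
    moreover have "card (set_mset \<gamma>) \<le> 1" using card_mono[OF _ \<open>set_mset \<gamma> \<subseteq> {0}\<close>] by simp
    ultimately show "bwitt (Pt 1 0) f = B1" unfolding bwitt_eq_B1 admits_0_right by blast
  }
  {
    assume "bwitt (Pt 1 0) f = B1"
    then obtain \<gamma> where \<gamma>: "coeff f \<gamma> \<noteq> 0" "card (set_mset \<gamma>) \<le> 1"
      unfolding bwitt_eq_B1 admits_0_right by blast
    have "inj_on (\<lambda>_. 0 :: nat) (set_mset \<gamma>)"
      using \<gamma>(2) card_le_Suc0_iff_eq[of "set_mset \<gamma>"] by (auto simp: inj_on_def)
    hence "coeff f (image_mset (\<lambda>_. 0) \<gamma>) \<noteq> 0" using \<gamma>(1) by (metis shape_relabel coeff_shape)
    moreover have "set_mset (image_mset (\<lambda>_. 0 :: nat) \<gamma>) \<subseteq> {0}" by auto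
    ultimately show "1\<^sub>W f = B1" using one by blast
  }
qed

section \<open>The action of the monomial symmetric functions\<close>

lemma witt_act_eq_B1:
  "witt_act h (bwitt c) f = B1 \<longleftrightarrow>
    (\<exists>\<gamma>. coeff f \<gamma> \<noteq> 0 \<and> (\<forall>i\<in>#\<gamma>. monomials_of (coeff h) i \<noteq> None)
      \<and> admits c (\<Sum>i\<in>#\<gamma>. the (monomials_of (coeff h) i)))"
  unfolding witt_act_def bwitt_eq_B1 plethysm.rep_eq
    subst_nonzero[OF is_sym_coeff finite_monomials_of] by blast

lemma part_0_pos: "part \<alpha> \<noteq> (\<lambda>_. 0) \<Longrightarrow> 0 < part \<alpha> 0"
proof (rule ccontr)
  assume "part \<alpha> \<noteq> (\<lambda>_. 0)" "\<not> 0 < part \<alpha> 0"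
  moreover have "part \<alpha> i \<le> part \<alpha> 0" for i by (rule part_antimono) simp
  ultimately show False by (simp add: fun_eq_iff)
qed

text \<open>
  If \<open>m\<^sub>\<alpha>\<close> is not constant, it has infinitely many monomials \<open>\<tau> k\<close> in pairwise disjoint sets of
  variables.  Substituting \<open>\<tau> k\<close> for \<open>x\<^sub>k\<close> in \<open>\<gamma>\<close> merges no exponents: the result has exactly the
  exponents \<open>\<gamma>\<^sub>k \<alpha>\<^sub>i\<close>.
\<close>

lemma disjoint_copies:
  assumes \<alpha>: "0 < part \<alpha> 0" and nz: "coeff f \<gamma> \<noteq> 0"
  shows "\<exists>\<gamma>'. coeff f \<gamma>' \<noteq> 0 \<and> (\<forall>i\<in>#\<gamma>'. monomials_of (coeff (msym \<alpha>)) i \<noteq> None)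
    \<and> (\<forall>j. count (\<Sum>i\<in>#\<gamma>'. the (monomials_of (coeff (msym \<alpha>)) i)) j
        = count \<gamma> (fst (prod_decode j)) * part \<alpha> (snd (prod_decode j)))"
proof -
  define \<tau> where "\<tau> k = image_mset (\<lambda>i. prod_encode (k, i)) (part_mono \<alpha>)" for k :: nat
  have count_\<tau>: "count (\<tau> k) j = (if fst (prod_decode j) = k then part \<alpha> (snd (prod_decode j)) else 0)" for k j
  proof (cases "fst (prod_decode j) = k")
    case True
    hence j: "j = prod_encode (k, snd (prod_decode j))" by (metis prod.collapse prod_decode_inverse)
    have "count (\<tau> k) (prod_encode (k, i)) = part \<alpha> i" for i
      unfolding \<tau>_def using count_image_mset_inj[of "\<lambda>i. prod_encode (k, i)" "part_mono \<alpha>" i]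
      by (simp add: inj_on_def)
    thus ?thesis using True j by metis
  next
    case False
    hence "j \<notin># \<tau> k" by (auto simp: \<tau>_def)
    thus ?thesis using False by (simp add: not_in_iff)
  qed
  have shape_\<tau>: "shape (\<tau> k) = \<alpha>" for k
    unfolding \<tau>_def by (subst shape_relabel) (auto simp: inj_on_def shape_part_mono)
  \<comment> \<open>Coefficients of \<open>m\<^sub>\<alpha>\<close> are 0 or 1, so the only copy of \<open>\<tau> k\<close> is the one numbered 0.\<close>
  define e where "e k = to_nat (\<tau> k, 0 :: nat)" for k
  have e: "monomials_of (coeff (msym \<alpha>)) (e k) = Some (\<tau> k)" for k
    by (simp add: e_def coeff_msym_shape shape_\<tau>)
  have "inj e"
  proof (rule injI)
    fix k l assume "e k = e l"
    hence "\<tau> k = \<tau> l" using e by (metis option.inject)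
    hence "count (\<tau> l) (prod_encode (k, 0)) = part \<alpha> 0"
      using count_\<tau>[of k "prod_encode (k, 0)"] by simp
    thus "k = l" using \<alpha> count_\<tau>[of l "prod_encode (k, 0)"] by (cases "k = l") simp_all
  qed
  hence "coeff f (image_mset e \<gamma>) \<noteq> 0" using nz by (metis coeff_shape shape_relabel inj_on_subset subset_UNIV)
  moreover have "count (\<Sum>i\<in>#image_mset e \<gamma>. the (monomials_of (coeff (msym \<alpha>)) i)) j
        = count \<gamma> (fst (prod_decode j)) * part \<alpha> (snd (prod_decode j))" for j
    by (induction \<gamma>) (simp_all add: e count_\<tau>)
  moreover have "\<forall>i\<in>#image_mset e \<gamma>. monomials_of (coeff (msym \<alpha>)) i \<noteq> None" by (simp add: e)
  ultimately show ?thesis by blast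
qed

lemma witt_act_Infty:
  assumes "0 < part \<alpha> 0"
  shows "witt_act (msym \<alpha>) (bwitt Infty) = bwitt Infty"
proof (rule ext, rule boole_eqI)
  fix f
  show "(witt_act (msym \<alpha>) (bwitt Infty) f = B1) = (bwitt Infty f = B1)"
    unfolding witt_act_eq_B1 bwitt_eq_B1 using disjoint_copies[OF assms, of f] by (metis admits.simps(2))
qed

text \<open>
  Each variable of \<open>\<gamma>\<close> is replaced by a monomial in which some exponent is \<open>\<alpha>\<^sub>1\<close>, so the substituted
  monomial has an exponent at least \<open>\<gamma>\<^sub>i \<alpha>\<^sub>1\<close>; disjoint copies have none larger than the maximum
  of these.
\<close>

lemma witt_act_bounded:
  assumes \<alpha>: "0 < part \<alpha> 0"
  shows "witt_act (msym \<alpha>) (bwitt (Pt 0 y)) = bwitt (Pt 0 (y div part \<alpha> 0))"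
proof (rule ext, rule boole_eqI, rule iffI)
  fix f assume "witt_act (msym \<alpha>) (bwitt (Pt 0 y)) f = B1"
  then obtain \<gamma> where \<gamma>: "coeff f \<gamma> \<noteq> 0" "\<And>i. i \<in># \<gamma> \<Longrightarrow> monomials_of (coeff (msym \<alpha>)) i \<noteq> None"
    "\<And>j. count (\<Sum>i\<in>#\<gamma>. the (monomials_of (coeff (msym \<alpha>)) i)) j \<le> y"
    unfolding witt_act_eq_B1 admits_0_left by blast
  have "count \<gamma> i \<le> y div part \<alpha> 0" for i
  proof (cases "i \<in># \<gamma>")
    case True
    then obtain \<kappa> where \<kappa>: "monomials_of (coeff (msym \<alpha>)) i = Some \<kappa>" using \<gamma>(2) by blast
    hence "shape \<kappa> = \<alpha>" using monomials_of_SomeD[OF \<kappa>] by (auto simp: coeff_msym_shape split: if_splits)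
    then obtain \<pi> where "bij \<pi>" "\<kappa> = image_mset \<pi> (part_mono \<alpha>)" using shape_orbit by metis
    hence "count \<kappa> (\<pi> 0) = part \<alpha> 0" by (simp add: count_image_mset_bij)
    hence "count \<gamma> i * part \<alpha> 0 \<le> y"
      using count_sum_mset_ge[of \<gamma> i "\<lambda>i. the (monomials_of (coeff (msym \<alpha>)) i)" "\<pi> 0"] \<gamma>(3) \<kappa>
      by (metis le_trans option.sel)
    thus ?thesis using \<alpha> by (simp add: less_eq_div_iff_mult_less_eq)
  qed (simp add: not_in_iff)
  thus "bwitt (Pt 0 (y div part \<alpha> 0)) f = B1" using \<gamma>(1) unfolding bwitt_eq_B1 admits_0_left by blast
next
  fix f assume "bwitt (Pt 0 (y div part \<alpha> 0)) f = B1"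
  then obtain \<gamma> where \<gamma>: "coeff f \<gamma> \<noteq> 0" "\<And>i. count \<gamma> i \<le> y div part \<alpha> 0"
    unfolding bwitt_eq_B1 admits_0_left by blast
  have "count \<gamma> i * part \<alpha> j \<le> y" for i j
  proof -
    have "count \<gamma> i * part \<alpha> j \<le> y div part \<alpha> 0 * part \<alpha> 0"
      using \<gamma>(2) part_antimono by (intro mult_le_mono) auto
    thus ?thesis using div_times_less_eq_dividend le_trans by blast
  qed
  thus "witt_act (msym \<alpha>) (bwitt (Pt 0 y)) f = B1"
    unfolding witt_act_eq_B1 admits_0_left using disjoint_copies[OF \<alpha> \<gamma>(1)] by metis
qed

section \<open>Classification of the Boolean Witt vectors\<close>

lemma admits_part_mono: "admits (Pt x y) (part_mono \<alpha>) \<longleftrightarrow> part \<alpha> x \<le> y"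
  using less_part_shape[of y "part_mono \<alpha>" x] by (simp add: shape_part_mono not_less[symmetric])

lemma admits_mono: "\<gamma> \<subseteq># \<delta> \<Longrightarrow> admits c \<delta> \<Longrightarrow> admits c \<gamma>"
proof (cases c)
  case (Pt x y)
  assume sub: "\<gamma> \<subseteq># \<delta>" and "admits c \<delta>"
  have "{j. y < count \<gamma> j} \<subseteq> {j. y < count \<delta> j}"
    using mset_subset_eq_count[OF sub] by (auto intro: less_le_trans)
  hence "card {j. y < count \<gamma> j} \<le> card {j. y < count \<delta> j}"
    by (rule card_mono[OF finite_level])
  thus "admits c \<gamma>" using \<open>admits c \<delta>\<close> Pt by simp
qed simp

text \<open>
  Let the large exponents of the two factors share the first \<open>x\<close> variables, and move the small exponents
  of the second factor beyond all variables of the first.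
\<close>

lemma admits_sum:
  assumes "admits c (part_mono \<alpha>)" "admits c (part_mono \<beta>)"
  shows "\<exists>g. inj g \<and> admits c (part_mono \<alpha> + image_mset g (part_mono \<beta>))"
proof (cases c)
  case (Pt x y)
  obtain N where N: "\<And>n. N \<le> n \<Longrightarrow> part \<alpha> n = 0" using part_eq_0 by blast
  define g where "g i = (if i < x then i else i + N)" for i
  have g: "inj g" by (auto simp: inj_def g_def split: if_splits)
  let ?\<delta> = "image_mset g (part_mono \<beta>)"
  have small: "part \<alpha> i \<le> y" "part \<beta> i \<le> y" if "x \<le> i" for i
    using assms Pt that part_antimono[OF that] by (simp_all only: admits_part_mono) (meson le_trans)+
  have "count (part_mono \<alpha> + ?\<delta>) j \<le> y" if j: "x \<le> j" for j
  proof (cases "j < x + N")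
    case True
    hence "j \<notin># ?\<delta>" using j by (auto simp: g_def)
    hence "count ?\<delta> j = 0" by (simp only: not_in_iff)
    thus ?thesis using small(1)[OF j] by simp
  next
    case False
    hence "j = g (j - N)" "x \<le> j - N" by (auto simp: g_def)
    hence "count ?\<delta> j \<le> y" using small(2) count_image_mset_inj[OF g] by (metis count_part_mono)
    thus ?thesis using False N by simp
  qed
  hence "{j. y < count (part_mono \<alpha> + ?\<delta>) j} \<subseteq> {..<x}" by (auto simp: not_le[symmetric])
  hence "card {j. y < count (part_mono \<alpha> + ?\<delta>) j} \<le> card {..<x}" by (rule card_mono[rotated]) simp
  hence "admits c (part_mono \<alpha> + ?\<delta>)" using Pt by simp
  thus ?thesis using g by blast
next
  case Infty
  thus ?thesis by (intro exI[of _ id]) simp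
qed

lemma bwitt_mult: "bwitt c (f * g) = bwitt c f * bwitt c g"
proof (rule boole_eqI, rule iffI)
  assume "bwitt c (f * g) = B1"
  then obtain \<gamma> \<delta> where "coeff f \<gamma> \<noteq> 0" "coeff g \<delta> \<noteq> 0" "admits c (\<gamma> + \<delta>)"
    unfolding bwitt_eq_B1 coeff_mult_nonzero by blast
  moreover from this have "admits c \<gamma>" "admits c \<delta>"
    using admits_mono mset_subset_eq_add_left mset_subset_eq_add_right by blast+
  ultimately show "bwitt c f * bwitt c g = B1" unfolding boole_mult bwitt_eq_B1 by blast
next
  assume "bwitt c f * bwitt c g = B1"
  then obtain \<gamma> \<delta> where nz: "coeff f \<gamma> \<noteq> 0" "coeff g \<delta> \<noteq> 0" and "admits c \<gamma>" "admits c \<delta>"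
    unfolding boole_mult bwitt_eq_B1 by blast
  hence "admits c (part_mono (shape \<gamma>))" "admits c (part_mono (shape \<delta>))"
    by (simp_all only: admits_shape[symmetric] shape_part_mono)
  then obtain h where h: "inj h" "admits c (part_mono (shape \<gamma>) + image_mset h (part_mono (shape \<delta>)))"
    using admits_sum by blast
  have "shape (image_mset h (part_mono (shape \<delta>))) = shape \<delta>"
    using shape_relabel[OF inj_on_subset[OF h(1)]] by (simp add: shape_part_mono)
  hence "coeff f (part_mono (shape \<gamma>)) \<noteq> 0" "coeff g (image_mset h (part_mono (shape \<delta>))) \<noteq> 0"
    using nz coeff_cong_shape[of "image_mset h (part_mono (shape \<delta>))" \<delta>] by (simp_all add: coeff_shape)
  thus "bwitt c (f * g) = B1" using h(2) unfolding bwitt_eq_B1 coeff_mult_nonzero by blast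
qed

lemma bwitt_1: "bwitt c 1 = 1"
proof -
  have "bwitt c 1 = B1"
    unfolding bwitt_eq_B1 by (rule exI[of _ "{#}"]) (simp add: one_sym.rep_eq admits_empty)
  thus ?thesis by (simp add: one_boole_def)
qed

lemma bwitt_in_Witt: "bwitt c \<in> Witt"
  by (simp add: Witt_def semiring_hom_def bwitt_0 bwitt_1 bwitt_add bwitt_mult)

definition rect :: "nat \<Rightarrow> nat \<Rightarrow> partition" where
  "rect a b = shape (repeat_mset b (mset_set {..<a}))"

lemma part_rect: "part (rect a b) i = (if i < a then b else 0)"
proof -
  have "{j. k < count (repeat_mset b (mset_set {..<a})) j} = (if k < b then {..<a} else {})" for k
    by (auto simp: count_mset_set')
  hence "k < part (rect a b) i \<longleftrightarrow> k < (if i < a then b else 0)" for k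
    unfolding rect_def less_part_shape by simp
  thus ?thesis by (metis linorder_neqE_nat less_irrefl)
qed

lemma rect_le_shape: "part (rect a (Suc z)) i \<le> part (shape \<nu>) i" if "a \<le> card {j. z < count \<nu> j}"
  using that less_part_shape[of z \<nu> i] by (simp add: part_rect Suc_le_eq)

lemma card_level_rect: "shape \<gamma> = rect a (Suc z) \<Longrightarrow> card {j. z < count \<gamma> j} = a"
proof -
  assume "shape \<gamma> = rect a (Suc z)"
  hence "i < card {j. z < count \<gamma> j} \<longleftrightarrow> i < a" for i
    by (simp add: less_part_shape[symmetric] part_rect)
  thus ?thesis by (metis linorder_neqE_nat less_irrefl)
qed

locale boolean_witt_vector =
  fixes a :: "sym \<Rightarrow> boole"
  assumes a: "a \<in> Witt"
begin

definition accepts :: "partition \<Rightarrow> bool" where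
  "accepts \<alpha> \<longleftrightarrow> a (msym \<alpha>) = B1"

lemma eq_B1: "a f = B1 \<longleftrightarrow> (\<exists>\<gamma>. coeff f \<gamma> \<noteq> 0 \<and> accepts (shape \<gamma>))"
  unfolding accepts_def using a by (intro additive_eq_B1) (auto simp: Witt_def semiring_hom_def)

text \<open>
  Acceptance of \<open>m\<^sub>\<alpha> m\<^sub>\<beta>\<close> means that some term of this product is accepted, a term being a
  product of renamings of the two monomials.
\<close>

lemma accepts_mult: "accepts \<alpha> \<and> accepts \<beta> \<longleftrightarrow> (\<exists>\<gamma> \<delta>. shape \<gamma> = \<alpha> \<and> shape \<delta> = \<beta> \<and> accepts (shape (\<gamma> + \<delta>)))"
proof -
  have "a (msym \<alpha> * msym \<beta>) = a (msym \<alpha>) * a (msym \<beta>)"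
    using a by (auto simp: Witt_def semiring_hom_def)
  hence "accepts \<alpha> \<and> accepts \<beta> \<longleftrightarrow> a (msym \<alpha> * msym \<beta>) = B1" by (simp add: accepts_def boole_mult)
  also have "\<dots> \<longleftrightarrow> (\<exists>\<gamma> \<delta>. shape \<gamma> = \<alpha> \<and> shape \<delta> = \<beta> \<and> accepts (shape (\<gamma> + \<delta>)))"
    unfolding eq_B1 coeff_mult_nonzero coeff_msym_shape by auto
  finally show ?thesis .
qed

lemma accepts_antimono: "accepts \<alpha>" if "accepts \<beta>" "\<And>i. part \<alpha> i \<le> part \<beta> i"
proof -
  have "part_mono \<beta> = part_mono \<alpha> + (part_mono \<beta> - part_mono \<alpha>)"
    using part_mono_subset[OF that(2)] by simp
  hence "accepts (shape (part_mono \<alpha> + (part_mono \<beta> - part_mono \<alpha>)))"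
    using that(1) by (metis shape_part_mono)
  thus ?thesis using accepts_mult shape_part_mono by blast
qed

lemma accepts_directed: "\<exists>\<nu>. accepts \<nu> \<and> (\<forall>i. part \<alpha> i \<le> part \<nu> i) \<and> (\<forall>i. part \<beta> i \<le> part \<nu> i)"
  if accepts: "accepts \<alpha>" "accepts \<beta>"
proof -
  obtain \<gamma> \<delta> where "shape \<gamma> = \<alpha>" "shape \<delta> = \<beta>" "accepts (shape (\<gamma> + \<delta>))"
    using accepts accepts_mult[of \<alpha> \<beta>] by blast
  thus ?thesis using shape_mono[of \<gamma> "\<gamma> + \<delta>"] shape_mono[of \<delta> "\<gamma> + \<delta>"] by auto
qed

lemma accepts_nonempty: "\<exists>\<nu>. accepts \<nu>"
proof -
  have "a 1 = B1" using a by (simp add: Witt_def semiring_hom_def one_boole_def)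
  thus ?thesis unfolding eq_B1 by blast
qed

text \<open>
  A diagram is the union of the rectangles reaching from its top left corner to the end of a row.
  Finitely many of them are nonempty, so an accepted common upper bound exists, and it contains the
  whole diagram.
\<close>

lemma accepts_iff_rect: "accepts \<alpha> \<longleftrightarrow> (\<forall>i. accepts (rect (Suc i) (part \<alpha> i)))"
proof
  assume "accepts \<alpha>"
  thus "\<forall>i. accepts (rect (Suc i) (part \<alpha> i))"
    by (intro allI accepts_antimono[OF \<open>accepts \<alpha>\<close>]) (simp add: part_rect part_antimono)
next
  assume rects: "\<forall>i. accepts (rect (Suc i) (part \<alpha> i))"
  have "\<exists>\<nu>. accepts \<nu> \<and> (\<forall>i<n. part \<alpha> i \<le> part \<nu> i)" for n
  proof (induction n)
    case (Suc n)
    then obtain \<nu> where \<nu>: "accepts \<nu>" "\<And>i. i < n \<Longrightarrow> part \<alpha> i \<le> part \<nu> i" by blast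
    obtain \<nu>' where \<nu>': "accepts \<nu>'" "\<And>i. part \<nu> i \<le> part \<nu>' i"
      "\<And>i. part (rect (Suc n) (part \<alpha> n)) i \<le> part \<nu>' i"
      using accepts_directed[OF \<nu>(1), of "rect (Suc n) (part \<alpha> n)"] rects by blast
    have "part \<alpha> i \<le> part \<nu>' i" if "i < Suc n" for i
    proof (cases "i = n")
      case True
      thus ?thesis using \<nu>'(3)[of n] by (simp add: part_rect)
    next
      case False
      thus ?thesis using that \<nu>(2)[of i] \<nu>'(2)[of i] by linarith
    qed
    thus ?case using \<nu>'(1) by blast
  qed (use accepts_nonempty in auto)
  moreover obtain N where N: "\<And>n. N \<le> n \<Longrightarrow> part \<alpha> n = 0" using part_eq_0 by blast
  ultimately obtain \<nu> where "accepts \<nu>" "\<forall>i<N. part \<alpha> i \<le> part \<nu> i" by blast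
  moreover have "part \<alpha> i \<le> part \<nu> i" for i
    using \<open>\<forall>i<N. part \<alpha> i \<le> part \<nu> i\<close> N[of i] by (cases "i < N") auto
  ultimately show "accepts \<alpha>" using accepts_antimono by blast
qed

lemma accepts_rect_antimono: "accepts (rect m n)" if "accepts (rect m' n')" "m \<le> m'" "n \<le> n'"
  by (rule accepts_antimono[OF that(1)]) (use that in \<open>auto simp: part_rect\<close>)

lemma accepts_rect_0: "accepts (rect m n)" if "m = 0 \<or> n = 0"
proof -
  obtain \<nu> where "accepts \<nu>" using accepts_nonempty by blast
  thus ?thesis by (rule accepts_antimono) (use that in \<open>auto simp: part_rect\<close>)
qed

text \<open>
  An accepted term \<open>\<gamma> + \<delta>\<close> of the square of the rectangle has at most \<open>m\<close> exponents above \<open>z\<close>, since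
  the taller rectangle is rejected.  As \<open>\<gamma>\<close> and \<open>\<delta>\<close> each have \<open>m\<close> such exponents already, they
  occupy the same \<open>m\<close> variables, where their exponents add up to at least \<open>2 (z + 1) \<ge> z + 2\<close>.
\<close>

lemma accepts_rect_square:
  assumes "accepts (rect m (Suc z))" "\<not> accepts (rect (Suc m) (Suc z))"
  shows "accepts (rect m (Suc (Suc z)))"
proof -
  obtain \<gamma> \<delta> where *: "shape \<gamma> = rect m (Suc z)" "shape \<delta> = rect m (Suc z)" "accepts (shape (\<gamma> + \<delta>))"
    using assms(1) accepts_mult[of "rect m (Suc z)" "rect m (Suc z)"] by blast
  let ?S = "\<lambda>\<gamma> :: nat multiset. {j. z < count \<gamma> j}"
  have "\<not> Suc m \<le> card (?S (\<gamma> + \<delta>))"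
    using assms(2) accepts_antimono[OF *(3)] rect_le_shape by blast
  moreover have "card (?S \<gamma>) = m" "card (?S \<delta>) = m" using * by (simp_all add: card_level_rect)
  moreover have "?S \<gamma> \<subseteq> ?S (\<gamma> + \<delta>)" "?S \<delta> \<subseteq> ?S (\<gamma> + \<delta>)" by auto
  ultimately have "?S \<gamma> = ?S (\<gamma> + \<delta>)" "?S \<delta> = ?S (\<gamma> + \<delta>)"
    by (intro card_seteq[OF finite_level]; simp)+
  hence "?S \<gamma> = ?S \<delta>" by simp
  hence "z < count \<delta> j" if "z < count \<gamma> j" for j using that by blast
  hence "?S \<gamma> \<subseteq> {j. Suc z < count (\<gamma> + \<delta>) j}" by fastforce
  hence "m \<le> card {j. Suc z < count (\<gamma> + \<delta>) j}"
    using card_mono[OF finite_level[of "Suc z" "\<gamma> + \<delta>"]] \<open>card (?S \<gamma>) = m\<close> by blast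
  thus ?thesis using accepts_antimono[OF *(3)] rect_le_shape by blast
qed

text \<open>
  Unless all rectangles are accepted, let \<open>x\<close> be the largest number of rows for which every width is accepted, and \<open>y\<close> the largest width
  accepted with \<open>x + 1\<close> rows.  A rectangle of width \<open>y\<close> can be made arbitrarily tall, as otherwise
  squaring it would yield an accepted rectangle of size \<open>(x + 1) \<times> (y + 1)\<close>.
\<close>

lemma accepts_rect_cases:
  obtains "\<And>m n. accepts (rect m n)"
  | x y where "\<And>m n. accepts (rect m n) \<longleftrightarrow> m \<le> x \<or> n \<le> y"
proof (cases "\<forall>m n. accepts (rect m n)")
  case False
  then obtain m where "\<not> (\<forall>n. accepts (rect m n))" by blast
  then obtain x where x: "\<And>n. accepts (rect x n)" and x': "\<not> (\<forall>n. accepts (rect (Suc x) n))"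
    using ex_least_nat_less[of "\<lambda>m. \<not> (\<forall>n. accepts (rect m n))" m] accepts_rect_0 by blast
  then obtain n where "\<not> accepts (rect (Suc x) n)" by blast
  then obtain y where y: "accepts (rect (Suc x) y)" and y': "\<not> accepts (rect (Suc x) (Suc y))"
    using ex_least_nat_less[of "\<lambda>n. \<not> accepts (rect (Suc x) n)" n] accepts_rect_0 by blast
  have tall: "accepts (rect (Suc x + k) y)" for k
  proof (induction k)
    case (Suc k)
    show ?case
    proof (cases y)
      case (Suc z)
      have "\<not> accepts (rect (Suc x + k) (Suc y))" using y' accepts_rect_antimono by (metis le_add1 order_refl)
      thus ?thesis using accepts_rect_square[of "Suc x + k" z] \<open>accepts (rect (Suc x + k) y)\<close> Suc by auto
    qed (simp add: accepts_rect_0)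
  qed (simp add: y)
  have "accepts (rect m n) \<longleftrightarrow> m \<le> x \<or> n \<le> y" for m n
  proof
    assume "accepts (rect m n)"
    thus "m \<le> x \<or> n \<le> y" using y' accepts_rect_antimono[of m n "Suc x" "Suc y"] by force
  next
    assume "m \<le> x \<or> n \<le> y"
    thus "accepts (rect m n)"
      using accepts_rect_antimono[OF x[of n], of m n] accepts_rect_antimono[OF tall[of m], of m n] by auto
  qed
  thus thesis by (rule that(2))
qed (use that in blast)

lemma in_range_bwitt: "a \<in> range bwitt"
proof -
  have eqI: "a = bwitt c" if "\<And>\<alpha>. accepts \<alpha> \<longleftrightarrow> bwitt c (msym \<alpha>) = B1" for c
  proof (rule ext, rule boole_eqI)
    have "accepts (shape \<gamma>) \<longleftrightarrow> admits c \<gamma>" for \<gamma> using that admits_shape by blast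
    thus "a f = B1 \<longleftrightarrow> bwitt c f = B1" for f unfolding eq_B1 bwitt_eq_B1 by simp
  qed
  show ?thesis
  proof (rule accepts_rect_cases)
    assume "\<And>m n. accepts (rect m n)"
    hence "accepts \<alpha>" for \<alpha> using accepts_iff_rect by blast
    hence "a = bwitt Infty" by (intro eqI) (simp add: lin_ext_msym one_boole_def)
    thus ?thesis by blast
  next
    fix x y assume *: "\<And>m n. accepts (rect m n) \<longleftrightarrow> m \<le> x \<or> n \<le> y"
    have "accepts \<alpha> \<longleftrightarrow> part \<alpha> x \<le> y" for \<alpha>
    proof -
      have "accepts \<alpha> \<longleftrightarrow> (\<forall>i\<ge>x. part \<alpha> i \<le> y)" unfolding accepts_iff_rect[of \<alpha>] *
        by (meson Suc_le_eq not_le)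
      also have "\<dots> \<longleftrightarrow> part \<alpha> x \<le> y" by (meson order_refl order_trans part_antimono)
      finally show ?thesis .
    qed
    hence "a = bwitt (Pt x y)"
      by (intro eqI) (simp add: lin_ext_msym zero_boole_def one_boole_def Suc_le_eq not_less)
    thus ?thesis by blast
  qed
qed

end

lemma range_bwitt: "range bwitt = Witt"
  using bwitt_in_Witt boolean_witt_vector.in_range_bwitt[OF boolean_witt_vector.intro] by blast

section \<open>The order\<close>

lemma boole_le_iff: "a \<le> b \<longleftrightarrow> (a = B1 \<longrightarrow> b = B1)"
  by (cases a; cases b) (simp_all add: less_eq_boole_def)

lemma bwitt_le_iff: "bwitt c \<preceq>\<^sub>W bwitt d \<longleftrightarrow> (\<forall>\<gamma>. admits c \<gamma> \<longrightarrow> admits d \<gamma>)"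
proof
  assume le: "bwitt c \<preceq>\<^sub>W bwitt d"
  show "\<forall>\<gamma>. admits c \<gamma> \<longrightarrow> admits d \<gamma>"
    using le unfolding witt_le_def boole_le_iff by (metis admits_shape)
qed (auto simp: witt_le_def boole_le_iff bwitt_eq_B1)

lemma admits_rect: "admits (Pt x y) (part_mono (rect m n)) \<longleftrightarrow> m \<le> x \<or> n \<le> y"
  by (auto simp: admits_part_mono part_rect simp del: admits.simps)

text \<open>
  The rectangle with \<open>x\<close> rows and \<open>y' + 1\<close> columns is accepted by \<open>(x, y)\<close>, and by \<open>(x', y')\<close> only if
  \<open>x \<le> x'\<close>; the one with \<open>x' + 1\<close> rows and \<open>y\<close> columns tests \<open>y \<le> y'\<close>.
\<close>

lemma bwitt_Pt_le_iff: "bwitt (Pt x y) \<preceq>\<^sub>W bwitt (Pt x' y') \<longleftrightarrow> x \<le> x' \<and> y \<le> y'"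
proof
  assume "bwitt (Pt x y) \<preceq>\<^sub>W bwitt (Pt x' y')"
  hence *: "m \<le> x \<or> n \<le> y \<Longrightarrow> m \<le> x' \<or> n \<le> y'" for m n
    unfolding bwitt_le_iff using admits_rect by blast
  show "x \<le> x' \<and> y \<le> y'" using *[of x "Suc y'"] *[of "Suc x'" y] by auto
next
  assume "x \<le> x' \<and> y \<le> y'"
  moreover have "part \<alpha> x' \<le> y'" if "part \<alpha> x \<le> y" "x \<le> x'" "y \<le> y'" for \<alpha>
    using that part_antimono[of x x' \<alpha>] by linarith
  ultimately have "admits (Pt x y) (part_mono (shape \<gamma>)) \<longrightarrow> admits (Pt x' y') (part_mono (shape \<gamma>))" for \<gamma>
    unfolding admits_part_mono by blast
  thus "bwitt (Pt x y) \<preceq>\<^sub>W bwitt (Pt x' y')"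
    unfolding bwitt_le_iff by (metis admits_shape shape_part_mono)
qed

lemma bwitt_le_Infty: "bwitt c \<preceq>\<^sub>W bwitt Infty"
  unfolding bwitt_le_iff by simp

lemma not_bwitt_Infty_le: "\<not> bwitt Infty \<preceq>\<^sub>W bwitt (Pt x y)"
proof -
  have "\<not> admits (Pt x y) (part_mono (rect (Suc x) (Suc y)))" unfolding admits_rect by simp
  thus ?thesis unfolding bwitt_le_iff using admits.simps(2) by blast
qed

lemma inj_bwitt: "inj bwitt"
proof (rule injI)
  fix c d assume eq: "bwitt c = bwitt d"
  have "bwitt c \<preceq>\<^sub>W bwitt c" by (simp add: witt_le_def)
  hence "bwitt c \<preceq>\<^sub>W bwitt d" "bwitt d \<preceq>\<^sub>W bwitt c" using eq by simp_all
  thus "c = d"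
    using not_bwitt_Infty_le bwitt_Pt_le_iff by (cases c; cases d) (auto simp del: bwitt.simps)
qed

lemma bij_bwitt: "bij_betw bwitt UNIV Witt"
  using inj_bwitt range_bwitt by (simp add: bij_betw_def)

section \<open>The semiring map from the natural numbers\<close>

lemma witt_hom_nat: "witt_hom (\<lambda>x :: nat. bwitt (Pt x 0))"
  unfolding witt_hom_def
  by (simp add: bwitt_in_Witt witt_zero_eq witt_one_eq witt_plus_Pt witt_times_nat image_subset_iff
      del: bwitt.simps)

lemma witt_hom_nat_eq:
  assumes "witt_hom (h :: nat \<Rightarrow> sym \<Rightarrow> boole)"
  shows "h x = bwitt (Pt x 0)"
proof (induction x)
  case 0
  show ?case using assms by (simp add: witt_hom_def witt_zero_eq del: bwitt.simps)
next
  case (Suc x)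
  have "h (x + 1) = h x +\<^sub>W h 1" using assms unfolding witt_hom_def by blast
  also have "\<dots> = bwitt (Pt x 0) +\<^sub>W bwitt (Pt 1 0)"
    using assms Suc by (simp add: witt_hom_def witt_one_eq del: bwitt.simps)
  finally show ?case by (simp add: witt_plus_Pt del: bwitt.simps)
qed

theorem proposition4p9:
  shows
    "bij_betw bwitt UNIV Witt
    \<and> ((\<exists>!h :: nat \<Rightarrow> sym \<Rightarrow> boole. witt_hom h)
      \<and> (\<forall>h :: nat \<Rightarrow> sym \<Rightarrow> boole. witt_hom h \<longrightarrow> (\<forall>x. h x = bwitt (Pt x 0)))
      \<and> 0\<^sub>W = bwitt (Pt 0 0) \<and> 1\<^sub>W = bwitt (Pt 1 0)
      \<and> (\<forall>x x'. bwitt (Pt x 0) +\<^sub>W bwitt (Pt x' 0) = bwitt (Pt (x + x') 0)))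
    \<and> (\<forall>x y. bwitt (Pt x 0) +\<^sub>W bwitt (Pt 0 y) = bwitt (Pt x y))
    \<and> (\<forall>y y'. bwitt (Pt 0 y) +\<^sub>W bwitt (Pt 0 y') = bwitt (Pt 0 (max y y'))
      \<and> bwitt (Pt 0 y) *\<^sub>W bwitt (Pt 0 y') = bwitt (Pt 0 (min y y')))
    \<and> (\<forall>z\<in>Witt. bwitt Infty +\<^sub>W z = bwitt Infty)
    \<and> (bwitt Infty *\<^sub>W bwitt Infty = bwitt Infty
      \<and> (\<forall>y. bwitt Infty *\<^sub>W bwitt (Pt 0 y) = bwitt (Pt 0 y)))
    \<and> (\<forall>\<alpha>. part \<alpha> \<noteq> (\<lambda>_. 0) \<longrightarrow> witt_act (msym \<alpha>) (bwitt Infty) = bwitt Infty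
      \<and> (\<forall>y. witt_act (msym \<alpha>) (bwitt (Pt 0 y)) = bwitt (Pt 0 (y div part \<alpha> 0))))
    \<and> ((\<forall>x\<^sub>1 y\<^sub>1 x\<^sub>2 y\<^sub>2. bwitt (Pt x\<^sub>1 y\<^sub>1) \<preceq>\<^sub>W bwitt (Pt x\<^sub>2 y\<^sub>2) \<longleftrightarrow> x\<^sub>1 \<le> x\<^sub>2 \<and> y\<^sub>1 \<le> y\<^sub>2)
      \<and> (\<forall>z\<in>Witt. z \<preceq>\<^sub>W bwitt Infty)
      \<and> (\<forall>x y. \<not> bwitt Infty \<preceq>\<^sub>W bwitt (Pt x y)))"
proof -
  have hom: "\<exists>!h :: nat \<Rightarrow> sym \<Rightarrow> boole. witt_hom h"
    by (rule ex1I[of _ "\<lambda>x. bwitt (Pt x 0)"]) (auto simp: witt_hom_nat witt_hom_nat_eq simp del: bwitt.simps)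
  have all: "P z" if z: "z \<in> Witt" "\<And>c. P (bwitt c)" for P and z :: "sym \<Rightarrow> boole"
  proof -
    obtain c where "z = bwitt c" using z(1) range_bwitt by blast
    thus ?thesis using z(2) by simp
  qed
  have infty_plus: "bwitt Infty +\<^sub>W z = bwitt Infty" if "z \<in> Witt" for z
    by (rule all[OF that]) (rule witt_plus_Infty)
  have le_infty: "z \<preceq>\<^sub>W bwitt Infty" if "z \<in> Witt" for z
    by (rule all[OF that]) (rule bwitt_le_Infty)
  have plus: "bwitt (Pt x 0) +\<^sub>W bwitt (Pt x' 0) = bwitt (Pt (x + x') 0)"
    "bwitt (Pt x 0) +\<^sub>W bwitt (Pt 0 y) = bwitt (Pt x y)"
    "bwitt (Pt 0 y) +\<^sub>W bwitt (Pt 0 y') = bwitt (Pt 0 (max y y'))" for x x' y y'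
    by (simp_all only: witt_plus_Pt add_0_left add_0_right max.idem max_0L)
  show ?thesis
    by (intro conjI allI ballI impI;
        rule bij_bwitt hom witt_hom_nat_eq witt_zero_eq witt_one_eq plus witt_times_bounded infty_plus
          witt_times_Infty_Infty witt_times_Infty_bounded witt_act_Infty[OF part_0_pos]
          witt_act_bounded[OF part_0_pos] bwitt_Pt_le_iff le_infty not_bwitt_Infty_le;
        assumption?)
qed

end
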